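(* There is an algorithm for $Q|\mathit{HM}|C_{\max}$ that, given any instance $\mathcal{I}$ and a preemptively feasible makespan $T$ for $\mathcal{I}$, computes a schedule (in high-multiplicity configuration format) with makespan at most $T+p_{\max}$ in time $\mathcal{O}(\langle\mathcal{I}\rangle)$, where $p_{\max}$ is the largest job processing time.
   Context: The problem $Q|\mathit{HM}|C_{\max}$ is makespan minimization on uniformly related machines in high-multiplicity encoding: the input consists of a list of pairs $(p_1,\eta_1),\ldots,(p_n,\eta_n)$ of positive integers, meaning there are $\eta_j$ jobs with processing time $p_j$, and a list of pairs $(s_1,\mu_1),\ldots,(s_m,\mu_m)$ of positive integers, meaning there are $\mu_i$ machines with speed $s_i$; all numbers are encoded in binary. The encoding size is $\langle\mathcal{I}\rangle\coloneqq\sum_{x}(\log(|x|+1)+1)$, summed over all numbers $x$ of the instance. A schedule assigns every job to a machine; the completion time of a machine of speed $s$ is the total processing time of its jobs divided by $s$, and the makespan is the largest completion time. The schedule is output as a list of configurations with multiplicities: each entry specifies a machine speed $s_i$, a number of machines of that speed, and for each job processing time the number of jobs of that processing time placed on each of these machines. In the preemptive relaxation, jobs may be interrupted and resumed on different machines; $T$ is preemptively feasible if the preemptive relaxation admits a schedule with makespan at most $T$. *)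

theory Defs
  imports Complex_Main "HOL-Library.Log_Nat"
begin

section \<open>High-multiplicity instances on uniformly related machines\<close>

text \<open>
  Lists of pairs \<open>(p\<^sub>j, \<eta>\<^sub>j)\<close> and \<open>(s\<^sub>i, \<mu>\<^sub>i)\<close>. Types are indexed from 0. Neither the processing
  times nor the speeds are assumed to be distinct, and the lists need not be sorted.
\<close>

record hm_instance =
  job_types :: "(nat \<times> nat) list"
  machine_types :: "(nat \<times> nat) list"

definition hm_valid :: "hm_instance \<Rightarrow> bool" where
  "hm_valid I \<longleftrightarrow> job_types I \<noteq> [] \<and> machine_types I \<noteq> [] \<and>
     (\<forall>(p, \<eta>) \<in> set (job_types I). p > 0 \<and> \<eta> > 0) \<and>
     (\<forall>(s, \<mu>) \<in> set (machine_types I). s > 0 \<and> \<mu> > 0)"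

definition hm_numbers :: "hm_instance \<Rightarrow> nat list" where
  "hm_numbers I = concat (map (\<lambda>(x, y). [x, y]) (job_types I @ machine_types I))"

definition encoding_size :: "hm_instance \<Rightarrow> real" where
  "encoding_size I = (\<Sum>x\<leftarrow>hm_numbers I. log 2 (real x + 1) + 1)"

text \<open>
  The job \<open>(j, k)\<close> is the \<open>k\<close>-th copy of job type \<open>j\<close>; the machine \<open>(i, l)\<close> is the \<open>l\<close>-th copy
  of machine type \<open>i\<close>.
\<close>

type_synonym job = "nat \<times> nat"
type_synonym machine = "nat \<times> nat"

definition jobs :: "hm_instance \<Rightarrow> job set" where
  "jobs I = {(j, k). j < length (job_types I) \<and> k < snd (job_types I ! j)}"

definition machines :: "hm_instance \<Rightarrow> machine set" where
  "machines I = {(i, l). i < length (machine_types I) \<and> l < snd (machine_types I ! i)}"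

definition ptime :: "hm_instance \<Rightarrow> job \<Rightarrow> nat" where
  "ptime I x = fst (job_types I ! fst x)"

definition speed :: "hm_instance \<Rightarrow> machine \<Rightarrow> nat" where
  "speed I y = fst (machine_types I ! fst y)"

definition p_max :: "hm_instance \<Rightarrow> nat" where
  "p_max I = Max (fst ` set (job_types I))"


section \<open>Schedules and makespan\<close>

definition schedule :: "hm_instance \<Rightarrow> (job \<Rightarrow> machine) \<Rightarrow> bool" where
  "schedule I \<sigma> \<longleftrightarrow> (\<forall>x \<in> jobs I. \<sigma> x \<in> machines I)"

definition completion_time :: "hm_instance \<Rightarrow> (job \<Rightarrow> machine) \<Rightarrow> machine \<Rightarrow> real" where
  "completion_time I \<sigma> y = real (\<Sum>x \<in> {x \<in> jobs I. \<sigma> x = y}. ptime I x) / real (speed I y)"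

definition makespan :: "hm_instance \<Rightarrow> (job \<Rightarrow> machine) \<Rightarrow> real" where
  "makespan I \<sigma> = Max (completion_time I \<sigma> ` machines I)"


section \<open>Preemptive relaxation\<close>

text \<open>
  A piece \<open>(x, y, u, v)\<close> says that job \<open>x\<close> runs on machine \<open>y\<close> during \<open>[u, v)\<close>. Two different
  pieces of the same job (even on different machines) or on the same machine must not overlap in
  time.
\<close>

definition preemptive_schedule ::
    "hm_instance \<Rightarrow> real \<Rightarrow> (job \<times> machine \<times> real \<times> real) set \<Rightarrow> bool" where
  "preemptive_schedule I T P \<longleftrightarrow>
     finite P \<and>
     (\<forall>(x, y, u, v) \<in> P. x \<in> jobs I \<and> y \<in> machines I \<and> 0 \<le> u \<and> u < v \<and> v \<le> T) \<and>
     (\<forall>(x, y, u, v) \<in> P. \<forall>(x', y', u', v') \<in> P.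
        (x, y, u, v) \<noteq> (x', y', u', v') \<and> (x = x' \<or> y = y') \<longrightarrow> {u..<v} \<inter> {u'..<v'} = {}) \<and>
     (\<forall>x \<in> jobs I.
        (\<Sum>(x', y, u, v) \<in> {q \<in> P. fst q = x}. real (speed I y) * (v - u)) = real (ptime I x))"

definition preemptively_feasible :: "hm_instance \<Rightarrow> real \<Rightarrow> bool" where
  "preemptively_feasible I T \<longleftrightarrow> (\<exists>P. preemptive_schedule I T P)"


section \<open>The configuration format\<close>

text \<open>
  An entry \<open>(i, r, js)\<close> stands for \<open>r\<close> machines of type \<open>i\<close>, each of which receives \<open>c\<close> jobs of
  type \<open>j\<close> for every \<open>(j, c)\<close> in \<open>js\<close>, and no job of a type that does not occur in \<open>js\<close>. Only
  nonzero counts are listed: with zeros, a list of configurations may consist of about \<open>n * m\<close>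
  numbers, which is not linear in the encoding size.
\<close>

type_synonym config_entry = "nat \<times> nat \<times> (nat \<times> nat) list"

definition config_vector :: "(nat \<times> nat) list \<Rightarrow> nat \<Rightarrow> nat" where
  "config_vector js j = (case map_of js j of None \<Rightarrow> 0 | Some c \<Rightarrow> c)"

definition wf_entry :: "hm_instance \<Rightarrow> config_entry \<Rightarrow> bool" where
  "wf_entry I = (\<lambda>(i, r, js). i < length (machine_types I) \<and> r > 0 \<and> distinct (map fst js) \<and>
     (\<forall>(j, c) \<in> set js. j < length (job_types I) \<and> c > 0))"

definition machine_config :: "hm_instance \<Rightarrow> (job \<Rightarrow> machine) \<Rightarrow> machine \<Rightarrow> nat \<Rightarrow> nat" where
  "machine_config I \<sigma> y j = card {k. (j, k) \<in> jobs I \<and> \<sigma> (j, k) = y}"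

text \<open>
  All machines have to be accounted for, including those without jobs.
\<close>

definition represents :: "hm_instance \<Rightarrow> config_entry list \<Rightarrow> (job \<Rightarrow> machine) \<Rightarrow> bool" where
  "represents I cs \<sigma> \<longleftrightarrow> (\<forall>e \<in> set cs. wf_entry I e) \<and>
     (\<forall>i < length (machine_types I). \<forall>f.
        card {l. (i, l) \<in> machines I \<and> machine_config I \<sigma> (i, l) = f} =
        (\<Sum>(i', r, js)\<leftarrow>cs. if i' = i \<and> config_vector js = f then r else 0))"

text \<open>
  The count precedes the type index, so that 0 can mark the end of an entry.
\<close>

definition encode_entry :: "config_entry \<Rightarrow> nat list" where
  "encode_entry = (\<lambda>(i, r, js). i # r # concat (map (\<lambda>(j, c). [c, j]) js) @ [0])"

definition encode_configs :: "config_entry list \<Rightarrow> nat list" where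
  "encode_configs cs = concat (map encode_entry cs)"


section \<open>Word RAM programs\<close>

text \<open>
  Structured programs over registers, an indirectly addressable memory and a write-only output.
  Values are unsigned \<open>w\<close>-bit words, and every read, constant, arithmetic operation, write and
  branch takes unit time. A computation that produces a value of more than \<open>w\<close> bits is stuck.
  Subtraction is truncated, so it also serves for comparisons; conditions test for a nonzero value.
\<close>

datatype binop = Add | Sub | Mul | Div

datatype expr = Const nat | Reg nat | Mem expr | Bin binop expr expr

datatype prog =
    Skip
  | Assign nat expr
  | Store expr expr
  | Write expr
  | Seq prog prog
  | If expr prog prog
  | While expr prog

record state =
  regs :: "nat \<Rightarrow> nat"
  mem :: "nat \<Rightarrow> nat"
  out :: "nat list"

primrec binop_val :: "binop \<Rightarrow> nat \<Rightarrow> nat \<Rightarrow> nat" where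
  "binop_val Add x y = x + y"
| "binop_val Sub x y = x - y"
| "binop_val Mul x y = x * y"
| "binop_val Div x y = x div y"

primrec expr_val :: "state \<Rightarrow> expr \<Rightarrow> nat" where
  "expr_val st (Const x) = x"
| "expr_val st (Reg r) = regs st r"
| "expr_val st (Mem e) = mem st (expr_val st e)"
| "expr_val st (Bin f e1 e2) = binop_val f (expr_val st e1) (expr_val st e2)"

primrec expr_fits :: "nat \<Rightarrow> state \<Rightarrow> expr \<Rightarrow> bool" where
  "expr_fits w st (Const x) \<longleftrightarrow> x < 2 ^ w"
| "expr_fits w st (Reg r) \<longleftrightarrow> regs st r < 2 ^ w"
| "expr_fits w st (Mem e) \<longleftrightarrow> expr_fits w st e \<and> mem st (expr_val st e) < 2 ^ w"
| "expr_fits w st (Bin f e1 e2) \<longleftrightarrow> expr_fits w st e1 \<and> expr_fits w st e2 \<and>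
     binop_val f (expr_val st e1) (expr_val st e2) < 2 ^ w"

primrec expr_cost :: "expr \<Rightarrow> nat" where
  "expr_cost (Const x) = 1"
| "expr_cost (Reg r) = 1"
| "expr_cost (Mem e) = expr_cost e + 1"
| "expr_cost (Bin f e1 e2) = expr_cost e1 + expr_cost e2 + 1"

text \<open>
  \<open>exec w c s t s'\<close>: with word length \<open>w\<close>, program \<open>c\<close> started in state \<open>s\<close> halts after \<open>t\<close> steps
  in state \<open>s'\<close>.
\<close>

inductive exec :: "nat \<Rightarrow> prog \<Rightarrow> state \<Rightarrow> nat \<Rightarrow> state \<Rightarrow> bool" for w where
  Skip: "exec w Skip s 1 s"
| Assign: "expr_fits w s e \<Longrightarrow>
    exec w (Assign r e) s (expr_cost e + 1) (s\<lparr>regs := (regs s)(r := expr_val s e)\<rparr>)"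
| Store: "expr_fits w s e1 \<Longrightarrow> expr_fits w s e2 \<Longrightarrow>
    exec w (Store e1 e2) s (expr_cost e1 + expr_cost e2 + 1)
      (s\<lparr>mem := (mem s)(expr_val s e1 := expr_val s e2)\<rparr>)"
| Write: "expr_fits w s e \<Longrightarrow>
    exec w (Write e) s (expr_cost e + 1) (s\<lparr>out := out s @ [expr_val s e]\<rparr>)"
| Seq: "exec w c1 s t1 s' \<Longrightarrow> exec w c2 s' t2 s'' \<Longrightarrow> exec w (Seq c1 c2) s (t1 + t2) s''"
| IfTrue: "expr_fits w s e \<Longrightarrow> expr_val s e \<noteq> 0 \<Longrightarrow> exec w c1 s t s' \<Longrightarrow>
    exec w (If e c1 c2) s (expr_cost e + 1 + t) s'"
| IfFalse: "expr_fits w s e \<Longrightarrow> expr_val s e = 0 \<Longrightarrow> exec w c2 s t s' \<Longrightarrow>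
    exec w (If e c1 c2) s (expr_cost e + 1 + t) s'"
| WhileFalse: "expr_fits w s e \<Longrightarrow> expr_val s e = 0 \<Longrightarrow>
    exec w (While e c) s (expr_cost e + 1) s"
| WhileTrue: "expr_fits w s e \<Longrightarrow> expr_val s e \<noteq> 0 \<Longrightarrow> exec w c s t1 s' \<Longrightarrow>
    exec w (While e c) s' t2 s'' \<Longrightarrow>
    exec w (While e c) s (expr_cost e + 1 + t1 + t2) s''"

inductive_cases exec_SkipE: "exec w Skip s t s'"
inductive_cases exec_AssignE: "exec w (Assign r e) s t s'"
inductive_cases exec_StoreE: "exec w (Store e1 e2) s t s'"
inductive_cases exec_WriteE: "exec w (Write e) s t s'"
inductive_cases exec_SeqE: "exec w (Seq c1 c2) s t s'"
inductive_cases exec_IfE: "exec w (If e c1 c2) s t s'"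
inductive_cases exec_WhileE: "exec w (While e c) s t s'"

lemma exec_deterministic:
  "exec w c s t s' \<Longrightarrow> exec w c s u s'' \<Longrightarrow> t = u \<and> s' = s''"
proof (induction arbitrary: u s'' rule: exec.induct)
  case (Skip s)
  then show ?case by (rule exec_SkipE) simp
next
  case (Assign s e r)
  from Assign.prems show ?case by (rule exec_AssignE) simp
next
  case (Store s e1 e2)
  from Store.prems show ?case by (rule exec_StoreE) simp
next
  case (Write s e)
  from Write.prems show ?case by (rule exec_WriteE) simp
next
  case (Seq c1 s t1 s1 c2 t2 s2)
  from Seq.prems show ?case
  proof (rule exec_SeqE)
    fix v1 r v2
    assume u: "u = v1 + v2" and 1: "exec w c1 s v1 r" and 2: "exec w c2 r v2 s''"
    from Seq.IH(1)[OF 1] have r: "t1 = v1" "s1 = r" by simp_all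
    with Seq.IH(2)[of v2 s''] 2 u show ?thesis by simp
  qed
next
  case (IfTrue s e c1 t s1 c2)
  from IfTrue.prems show ?case
  proof (rule exec_IfE)
    fix v
    assume u: "u = Suc (expr_cost e + v)" and 1: "exec w c1 s v s''"
    from IfTrue.IH[OF 1] u show ?thesis by simp
  qed (use IfTrue.hyps(2) in simp)
next
  case (IfFalse s e c2 t s1 c1)
  from IfFalse.prems show ?case
  proof (rule exec_IfE)
    fix v
    assume u: "u = Suc (expr_cost e + v)" and 1: "exec w c2 s v s''"
    from IfFalse.IH[OF 1] u show ?thesis by simp
  qed (use IfFalse.hyps(2) in simp)
next
  case (WhileFalse s e c)
  from WhileFalse.prems show ?case
    by (rule exec_WhileE) (use WhileFalse.hyps(2) in simp_all)
next
  case (WhileTrue s e c t1 s1 t2 s2)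
  from WhileTrue.prems show ?case
  proof (rule exec_WhileE)
    fix v1 r v2
    assume u: "u = Suc (expr_cost e + v1 + v2)" and 1: "exec w c s v1 r"
      and 2: "exec w (While e c) r v2 s''"
    from WhileTrue.IH(1)[OF 1] have r: "t1 = v1" "s1 = r" by simp_all
    with WhileTrue.IH(2)[of v2 s''] 2 u show ?thesis by simp
  qed (use WhileTrue.hyps(2) in simp)
qed


section \<open>Input of the algorithm\<close>

text \<open>
  The makespan \<open>T\<close> is given as a fraction \<open>a / b\<close>, not necessarily reduced.
\<close>

definition input :: "hm_instance \<Rightarrow> nat \<Rightarrow> nat \<Rightarrow> nat list" where
  "input I a b = [length (job_types I), length (machine_types I), a, b] @ hm_numbers I"

definition init_state :: "nat list \<Rightarrow> state" where
  "init_state xs = \<lparr>regs = (\<lambda>_. 0), mem = (\<lambda>k. if k < length xs then xs ! k else 0), out = []\<rparr>"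

text \<open>
  The number of bits of the largest number among the input numbers and the length of the input, so
  that one word of this many bits holds any input number or the address of any input cell.
\<close>

definition word_bits :: "nat list \<Rightarrow> nat" where
  "word_bits xs = floorlog 2 (Max (insert (length xs) (set xs)))"

end

theory Submission
  imports Defs
begin

text \<open>
  Preemptive feasibility of \<open>T\<close> is used only through the volume bound \<open>\<Sum> p\<^sub>j \<eta>\<^sub>j \<le> T \<Sum> \<mu>\<^sub>i s\<^sub>i\<close>.
  Take jobs and machines in the given order and put jobs on a machine until its load exceeds \<open>T s\<^sub>i\<close>.
  The last job exceeds \<open>T s\<^sub>i\<close> by at most \<open>p\<^sub>m\<^sub>a\<^sub>x \<le> p\<^sub>m\<^sub>a\<^sub>x s\<^sub>i\<close>, as speeds are positive integers, and by
  the volume bound the machines cannot all be overfull while jobs remain. No sorting is needed, and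
  by division all machines of a type that receive jobs of a single type only are treated at once, so
  every round of constantly many steps finishes a job type or a machine type.
\<close>

text \<open>There may be exponentially many jobs and machines in the encoding size, so neither the
  program nor its invariant speaks of individual ones. Only counts per type are tracked; any list of
  well-formed entries with the right counts is realised by some schedule, which is shown to exist
  afterwards and never computed. The output is write-only, so an entry has to be produced in the
  order in which it is written. This works because at most one machine is open at a time: its type
  and its multiplicity 1 are known when it is opened, and pairs are appended as they become known.
  The lists of entries and pairs exist only in the invariant, not in the machine. No logarithm
  enters the running time: there are at most \<open>n + m\<close> rounds and at most
  \<open>m\<close> steps for leftover machine types, while the encoding size is at least the number
  \<open>2 * (n + m)\<close> of numbers in the instance.\<close>

section \<open>The volume bound\<close>

text \<open>Induction by left end points: the interval added last starts latest, so by disjointness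
  all others end by \<open>u x\<close>, and the induction hypothesis applies with \<open>u x\<close>
  in place of \<open>T\<close>.\<close>

lemma sum_disjoint_intervals_le:
  fixes u v :: "'a \<Rightarrow> real"
  assumes "finite Q" "0 \<le> T"
    and "\<And>q. q \<in> Q \<Longrightarrow> 0 \<le> u q \<and> u q < v q \<and> v q \<le> T"
    and "\<And>q q'. q \<in> Q \<Longrightarrow> q' \<in> Q \<Longrightarrow> q \<noteq> q' \<Longrightarrow> {u q..<v q} \<inter> {u q'..<v q'} = {}"
  shows "(\<Sum>q\<in>Q. v q - u q) \<le> T"
  using assms
proof (induction arbitrary: T rule: finite_ranking_induct[where f = u])
  case empty
  then show ?case by simp
next
  case (insert x S)
  show ?case
  proof (cases "x \<in> S")
    case True
    then show ?thesis using insert by (simp add: insert_absorb)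
  next
    case False
    have "v y \<le> u x" if "y \<in> S" for y
    proof (rule ccontr)
      assume "\<not> v y \<le> u x"
      then have "u x \<in> {u x..<v x} \<inter> {u y..<v y}"
        using insert.hyps(2)[OF that] insert.prems(2)[of x] by auto
      moreover have "x \<noteq> y" using False that by auto
      ultimately show False using insert.prems(3)[of x y] that by auto
    qed
    then have "(\<Sum>q\<in>S. v q - u q) \<le> u x"
    proof (intro insert.IH)
      show "0 \<le> u x" using insert.prems(2)[of x] by simp
      show "0 \<le> u q \<and> u q < v q \<and> v q \<le> u x" if "q \<in> S" for q
        using insert.prems(2)[of q] that \<open>\<And>y. y \<in> S \<Longrightarrow> v y \<le> u x\<close> by simp
      show "{u q..<v q} \<inter> {u q'..<v q'} = {}" if "q \<in> S" "q' \<in> S" "q \<noteq> q'" for q q'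
        by (rule insert.prems(3)) (use that in simp_all)
    qed
    then show ?thesis using insert.hyps(1) insert.prems(2)[of x] False by simp
  qed
qed

lemma finite_jobs: "finite (jobs I)" and sum_jobs:
  "(\<Sum>x\<in>jobs I. f (fst x)) =
    (\<Sum>j<length (job_types I). snd (job_types I ! j) * (f j :: nat))"
proof -
  have *: "jobs I = (SIGMA j:{..<length (job_types I)}. {..<snd (job_types I ! j)})"
    by (auto simp: jobs_def)
  show "finite (jobs I)" unfolding * by simp
  show "(\<Sum>x\<in>jobs I. f (fst x)) =
    (\<Sum>j<length (job_types I). snd (job_types I ! j) * (f j :: nat))"
    unfolding * by (subst sum.Sigma[symmetric, where g = "\<lambda>j k. f j", unfolded split_def]) auto
qed

lemma finite_machines: "finite (machines I)" and sum_machines: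
  "(\<Sum>y\<in>machines I. f (fst y)) =
    (\<Sum>i<length (machine_types I). snd (machine_types I ! i) * (f i :: nat))"
proof -
  have *: "machines I = (SIGMA i:{..<length (machine_types I)}. {..<snd (machine_types I ! i)})"
    by (auto simp: machines_def)
  show "finite (machines I)" unfolding * by simp
  show "(\<Sum>y\<in>machines I. f (fst y)) =
    (\<Sum>i<length (machine_types I). snd (machine_types I ! i) * (f i :: nat))"
    unfolding * by (subst sum.Sigma[symmetric, where g = "\<lambda>j k. f j", unfolded split_def]) auto
qed

text \<open>Double counting of the processed volume. Grouped by job, the pieces give the total
  processing time; grouped by machine, at most \<open>T\<close> times the speed, as the pieces on
  one machine are disjoint intervals within \<open>[0, T)\<close>.\<close>

lemma preemptively_feasible_volume:
  assumes "preemptively_feasible I T" "0 \<le> T"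
  shows "real (\<Sum>x\<in>jobs I. ptime I x) \<le> T * real (\<Sum>y\<in>machines I. speed I y)"
proof -
  obtain P where P: "preemptive_schedule I T P"
    using assms(1) by (auto simp: preemptively_feasible_def)
  have fin: "finite P" using P by (simp add: preemptive_schedule_def)
  let ?w = "\<lambda>(x, y, u, v). real (speed I y) * (v - u :: real)"
  let ?y = "\<lambda>q. fst (snd q)" and ?u = "\<lambda>q. fst (snd (snd q))" and ?v = "\<lambda>q. snd (snd (snd q))"
  have elem: "fst q \<in> jobs I" "?y q \<in> machines I" "0 \<le> ?u q" "?u q < ?v q" "?v q \<le> T"
    if "q \<in> P" for q
    using P that by (auto simp: preemptive_schedule_def)
  have disj: "{?u q..<?v q} \<inter> {?u q'..<?v q'} = {}"
    if "q \<in> P" "q' \<in> P" "q \<noteq> q'" "?y q = ?y q'" for q q'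
  proof -
    have "\<forall>q\<in>P. \<forall>q'\<in>P. q \<noteq> q' \<and> (fst q = fst q' \<or> ?y q = ?y q') \<longrightarrow>
        {?u q..<?v q} \<inter> {?u q'..<?v q'} = {}"
      using P unfolding preemptive_schedule_def split_beta prod.collapse by (elim conjE)
    then show ?thesis using that by blast
  qed
  have "real (\<Sum>x\<in>jobs I. ptime I x) = (\<Sum>x\<in>jobs I. \<Sum>q\<in>{q \<in> P. fst q = x}. ?w q)"
    using P by (simp add: preemptive_schedule_def)
  also have "\<dots> = (\<Sum>q\<in>P. ?w q)"
    by (rule sum.group) (use fin finite_jobs elem in auto)
  also have "\<dots> = (\<Sum>y\<in>machines I. \<Sum>q\<in>{q \<in> P. ?y q = y}. ?w q)"
    by (rule sum.group[symmetric]) (use fin finite_machines elem in auto)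
  also have "\<dots> = (\<Sum>y\<in>machines I. real (speed I y) * (\<Sum>q\<in>{q \<in> P. ?y q = y}. ?v q - ?u q))"
    by (auto simp: sum_distrib_left intro!: sum.cong)
  also have "\<dots> \<le> (\<Sum>y\<in>machines I. real (speed I y) * T)"
    by (intro sum_mono mult_left_mono sum_disjoint_intervals_le)
       (use fin assms(2) elem disj in auto)
  finally show ?thesis by (simp add: sum_distrib_left mult.commute)
qed


section \<open>From configurations to a schedule\<close>

text \<open>The range \<open>0..<N\<close> is cut into consecutive blocks of lengths
  \<open>g y\<close>. This is applied twice: to deal out the copies of a machine type to entries,
  then the copies of a job type to machines.\<close>

lemma ex_map_with_fibre_cards:
  assumes "finite M" "(\<Sum>y\<in>M. g y) = (N :: nat)"
  shows "\<exists>\<tau>. (\<forall>k<N. \<tau> k \<in> M) \<and> (\<forall>y\<in>M. card {k. k < N \<and> \<tau> k = y} = g y)"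
  using assms
proof (induction arbitrary: N rule: finite_induct)
  case empty
  then show ?case by auto
next
  case (insert x M)
  define N' where "N' = (\<Sum>y\<in>M. g y)"
  have N: "N = N' + g x" using insert by (simp add: N'_def)
  obtain \<tau> where \<tau>: "\<forall>k<N'. \<tau> k \<in> M" "\<forall>y\<in>M. card {k. k < N' \<and> \<tau> k = y} = g y"
    using insert.IH[OF N'_def[symmetric]] by auto
  let ?\<tau> = "\<lambda>k. if k < N' then \<tau> k else x"
  have "{k. k < N \<and> ?\<tau> k = x} = {N'..<N}"
    using \<tau>(1) insert.hyps(2) N by (auto simp: not_less intro: leI)
  then have "card {k. k < N \<and> ?\<tau> k = x} = g x" using N by simp
  moreover have "{k. k < N \<and> ?\<tau> k = y} = {k. k < N' \<and> \<tau> k = y}" if "y \<in> M" for y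
    using that insert.hyps(2) N by auto
  ultimately show ?case using \<tau> by (intro exI[of _ ?\<tau>]) auto
qed

definition used :: "config_entry list \<Rightarrow> nat \<Rightarrow> nat" where
  "used es j = (\<Sum>(i, r, js)\<leftarrow>es. r * config_vector js j)"

definition taken :: "config_entry list \<Rightarrow> nat \<Rightarrow> nat" where
  "taken es i = (\<Sum>(i', r, js)\<leftarrow>es. if i' = i then r else 0)"

text \<open>Takes a function rather than a list of pairs, so that it applies to one configuration
  vector as well as to the total \<open>used es\<close>.\<close>

definition load :: "hm_instance \<Rightarrow> (nat \<Rightarrow> nat) \<Rightarrow> nat" where
  "load I f = (\<Sum>j<length (job_types I). fst (job_types I ! j) * f j)"

lemma config_vector_outside:
  assumes "wf_entry I (i, r, js)" "j \<ge> length (job_types I)"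
  shows "config_vector js j = 0"
  using assms by (auto simp: wf_entry_def config_vector_def split: option.split dest!: map_of_SomeD)

text \<open>The copies of a machine type are dealt out to positions in \<open>cs\<close>, not to
  vectors: several entries may share type and vector, and then their multiplicities add up.\<close>

lemma ex_machine_configs:
  assumes "\<And>i. i < length (machine_types I) \<Longrightarrow> taken cs i = snd (machine_types I ! i)"
  shows "\<exists>F. (\<forall>i<length (machine_types I). \<forall>f.
      card {l. (i, l) \<in> machines I \<and> F (i, l) = f} =
        (\<Sum>(i', r, js)\<leftarrow>cs. if i' = i \<and> config_vector js = f then r else 0)) \<and>
    (\<forall>y\<in>machines I. \<exists>r js. (fst y, r, js) \<in> set cs \<and> F y = config_vector js)"
proof -
  let ?type = "\<lambda>k. fst (cs ! k)" and ?r = "\<lambda>k. fst (snd (cs ! k))"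
  let ?f = "\<lambda>k. config_vector (snd (snd (cs ! k)))"
  let ?E = "\<lambda>i. {k \<in> {..<length cs}. ?type k = i}"
  let ?\<mu> = "\<lambda>i. snd (machine_types I ! i)"
  \<comment> \<open>A general \<open>Q\<close> serves both the total number of machines of a type
    (\<open>Q\<close> true) and the number with one given vector.\<close>
  have sum_E: "(\<Sum>k\<in>?E i. if Q (?f k) then ?r k else 0) =
      (\<Sum>(i', r, js)\<leftarrow>cs. if i' = i \<and> Q (config_vector js) then r else 0)" for i Q
  proof -
    have "(\<Sum>(i', r, js)\<leftarrow>cs. if i' = i \<and> Q (config_vector js) then r else 0) =
      (\<Sum>k<length cs. if ?type k = i then if Q (?f k) then ?r k else 0 else 0)"
      by (auto simp: sum_list_sum_nth atLeast0LessThan split_def intro!: sum.cong)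
    also have "\<dots> = (\<Sum>k\<in>?E i. if Q (?f k) then ?r k else 0)"
      by (rule sum.inter_filter[symmetric]) simp
    finally show ?thesis ..
  qed
  have "\<exists>\<tau>. (\<forall>l<?\<mu> i. \<tau> l \<in> ?E i) \<and> (\<forall>k\<in>?E i. card {l. l < ?\<mu> i \<and> \<tau> l = k} = ?r k)"
      (is "\<exists>\<tau>. ?good i \<tau>")
    if "i < length (machine_types I)" for i
    using assms[OF that] sum_E[of "\<lambda>_. True" i]
    by (intro ex_map_with_fibre_cards) (auto simp: taken_def)
  then have "\<exists>\<tau>. \<forall>i. i < length (machine_types I) \<longrightarrow> ?good i (\<tau> i)"
    by (intro choice) blast
  then obtain \<tau> where \<tau>: "\<And>i l. i < length (machine_types I) \<Longrightarrow> l < ?\<mu> i \<Longrightarrow> \<tau> i l \<in> ?E i"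
    "\<And>i k. i < length (machine_types I) \<Longrightarrow> k \<in> ?E i \<Longrightarrow> card {l. l < ?\<mu> i \<and> \<tau> i l = k} = ?r k"
    by blast
  show ?thesis
  proof (intro exI[of _ "\<lambda>(i, l). ?f (\<tau> i l)"] conjI allI impI ballI)
    fix i f
    assume i: "i < length (machine_types I)"
    have fibre: "{l. (i, l) \<in> machines I \<and> ?f (\<tau> i l) = f} =
      (\<Union>k\<in>{k \<in> ?E i. ?f k = f}. {l. l < ?\<mu> i \<and> \<tau> i l = k})"
      using \<tau>(1)[OF i] i by (auto simp: machines_def)
    have "card {l. (i, l) \<in> machines I \<and> ?f (\<tau> i l) = f} =
      (\<Sum>k\<in>{k \<in> ?E i. ?f k = f}. card {l. l < ?\<mu> i \<and> \<tau> i l = k})"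
      unfolding fibre by (rule card_UN_disjoint) auto
    also have "\<dots> = (\<Sum>k\<in>{k \<in> ?E i. ?f k = f}. ?r k)"
      by (intro sum.cong refl \<tau>(2)[OF i]) simp
    also have "\<dots> = (\<Sum>k\<in>?E i. if ?f k = f then ?r k else 0)"
      by (subst sum.inter_filter) simp_all
    also note sum_E[of "\<lambda>f'. f' = f" i]
    finally show "card {l. (i, l) \<in> machines I \<and> (case (i, l) of (i, l) \<Rightarrow> ?f (\<tau> i l)) = f} =
        (\<Sum>(i', r, js)\<leftarrow>cs. if i' = i \<and> config_vector js = f then r else 0)"
      by simp
  next
    fix y
    assume "y \<in> machines I"
    then obtain i l where y: "y = (i, l)" "i < length (machine_types I)" "l < ?\<mu> i"
      by (auto simp: machines_def)
    obtain r js where "cs ! \<tau> i l = (i, r, js)" "\<tau> i l < length cs"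
      using \<tau>(1)[OF y(2,3)] by (cases "cs ! \<tau> i l") auto
    then show "\<exists>r js. (fst y, r, js) \<in> set cs \<and> (case y of (i, l) \<Rightarrow> ?f (\<tau> i l)) = config_vector js"
      using y(1) nth_mem[of "\<tau> i l" cs] by auto
  qed
qed

text \<open>Once every machine has a vector \<open>F y\<close>, the job types are independent: the
  jobs of type \<open>j\<close> need only be split into parts of sizes \<open>F y j\<close>, and
  these add up to \<open>used cs j\<close>, the number of jobs of that type.\<close>

lemma ex_schedule:
  assumes wf: "\<And>e. e \<in> set cs \<Longrightarrow> wf_entry I e"
    and taken: "\<And>i. i < length (machine_types I) \<Longrightarrow> taken cs i = snd (machine_types I ! i)"
    and used: "\<And>j. j < length (job_types I) \<Longrightarrow> used cs j = snd (job_types I ! j)"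
  shows "\<exists>\<sigma>. schedule I \<sigma> \<and> represents I cs \<sigma> \<and>
    (\<forall>y\<in>machines I. \<exists>r js. (fst y, r, js) \<in> set cs \<and>
      completion_time I \<sigma> y = real (load I (config_vector js)) / real (speed I y))"
proof -
  let ?\<eta> = "\<lambda>j. snd (job_types I ! j)"
  obtain F where F:
    "\<And>i f. i < length (machine_types I) \<Longrightarrow>
      card {l. (i, l) \<in> machines I \<and> F (i, l) = f} =
        (\<Sum>(i', r, js)\<leftarrow>cs. if i' = i \<and> config_vector js = f then r else 0)"
    "\<And>y. y \<in> machines I \<Longrightarrow> \<exists>r js. (fst y, r, js) \<in> set cs \<and> F y = config_vector js"
    using ex_machine_configs[OF taken] by blast
  \<comment> \<open>The finitely many vectors that occur. Grouping the machines by type and then by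
    vector makes the counts in \<open>F\<close> applicable; exchanging the sums then isolates each
    entry.\<close>
  let ?V = "(\<lambda>(i, r, js). config_vector js) ` set cs"
  have total: "(\<Sum>y\<in>machines I. F y j) = used cs j" for j
  proof -
    let ?M = "{..<length (machine_types I)}"
    have fin: "finite {l. (i, l) \<in> machines I}" for i
      by (simp add: machines_def)
    have "machines I = (SIGMA i:?M. {l. (i, l) \<in> machines I})"
      by (auto simp: machines_def)
    then have "(\<Sum>y\<in>machines I. F y j) = (\<Sum>y\<in>(SIGMA i:?M. {l. (i, l) \<in> machines I}). F y j)"
      by (rule arg_cong)
    also have "\<dots> = (\<Sum>i\<in>?M. \<Sum>l\<in>{l. (i, l) \<in> machines I}. F (i, l) j)"
      using fin by (subst sum.Sigma) auto
    also have "\<dots> = (\<Sum>i\<in>?M. \<Sum>f\<in>?V. \<Sum>l\<in>{l \<in> {l. (i, l) \<in> machines I}. F (i, l) = f}. F (i, l) j)"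
      by (intro sum.cong refl sum.group[symmetric] fin) (auto dest!: F(2) intro: rev_image_eqI)
    also have "\<dots> = (\<Sum>i\<in>?M. \<Sum>f\<in>?V. card {l. (i, l) \<in> machines I \<and> F (i, l) = f} * f j)"
      by (intro sum.cong refl) auto
    also have "\<dots> = (\<Sum>i\<in>?M. \<Sum>f\<in>?V. (\<Sum>(i', r, js)\<leftarrow>cs. if i' = i \<and> config_vector js = f then r else 0) * f j)"
      using F(1) by (intro sum.cong refl) auto
    also have "\<dots> = (\<Sum>i\<in>?M. \<Sum>f\<in>?V. \<Sum>(i', r, js)\<leftarrow>cs. if i' = i \<and> config_vector js = f then r * f j else 0)"
      by (auto simp: sum_list_mult_const[symmetric] split_def intro!: sum.cong arg_cong[where f = sum_list])
    also have "\<dots> = (\<Sum>(i', r, js)\<leftarrow>cs. \<Sum>i\<in>?M. \<Sum>f\<in>?V. if i' = i \<and> config_vector js = f then r * f j else 0)"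
      by (simp add: sum_list_sum_nth split_def sum.swap[of _ "{0..<length cs}"])
    also have "\<dots> = (\<Sum>(i', r, js)\<leftarrow>cs. r * config_vector js j)"
    proof (intro arg_cong[where f = sum_list] map_cong refl)
      fix en
      assume en: "en \<in> set cs"
      obtain i' r js where [simp]: "en = (i', r, js)" by (cases en)
      have i': "i' \<in> ?M" using wf[OF en] by (simp add: wf_entry_def)
      have v: "config_vector js \<in> ?V" using en by force
      have "(\<Sum>i\<in>?M. \<Sum>f\<in>?V. if i' = i \<and> config_vector js = f then r * f j else 0) =
        (\<Sum>i\<in>?M. if i' = i then \<Sum>f\<in>?V. if config_vector js = f then r * f j else 0 else 0)"
        by (intro sum.cong) auto
      also have "\<dots> = r * config_vector js j"
        using i' v by (simp only: sum.delta'[OF finite_lessThan] sum.delta'[OF finite_imageI[OF finite_set]] if_True)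
      finally show "(case en of (i', r, js) \<Rightarrow> \<Sum>i\<in>?M. \<Sum>f\<in>?V.
          if i' = i \<and> config_vector js = f then r * f j else 0) =
        (case en of (i, r, js) \<Rightarrow> r * config_vector js j)"
        by simp
    qed
    finally show ?thesis by (simp add: used_def)
  qed
  have "\<exists>\<tau>. (\<forall>k<?\<eta> j. \<tau> k \<in> machines I) \<and>
      (\<forall>y\<in>machines I. card {k. k < ?\<eta> j \<and> \<tau> k = y} = F y j)" (is "\<exists>\<tau>. ?good j \<tau>")
    if "j < length (job_types I)" for j
    using used[OF that] total[of j] by (intro ex_map_with_fibre_cards finite_machines) simp
  then have "\<exists>\<tau>. \<forall>j. j < length (job_types I) \<longrightarrow> ?good j (\<tau> j)"
    by (intro choice) blast
  then obtain \<tau> where \<tau>: "\<And>j k. j < length (job_types I) \<Longrightarrow> k < ?\<eta> j \<Longrightarrow> \<tau> j k \<in> machines I"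
    "\<And>j y. j < length (job_types I) \<Longrightarrow> y \<in> machines I \<Longrightarrow> card {k. k < ?\<eta> j \<and> \<tau> j k = y} = F y j"
    by blast
  let ?\<sigma> = "\<lambda>(j, k). \<tau> j k"
  have mc: "machine_config I ?\<sigma> y = F y" if y: "y \<in> machines I" for y
  proof
    fix j
    obtain r js where js: "(fst y, r, js) \<in> set cs" "F y = config_vector js"
      using F(2)[OF y] by auto
    show "machine_config I ?\<sigma> y j = F y j"
    proof (cases "j < length (job_types I)")
      case True
      then show ?thesis using \<tau>(2)[OF True y] by (simp add: machine_config_def jobs_def)
    next
      \<comment> \<open>\<open>represents\<close> compares vectors as functions on all natural
        numbers, so they must also agree beyond the last job type, where both are 0.\<close>
      case False
      then show ?thesis using js(2) config_vector_outside[OF wf[OF js(1)]]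
        by (simp add: machine_config_def jobs_def)
    qed
  qed
  show ?thesis
  proof (intro exI[of _ ?\<sigma>] conjI ballI)
    show "schedule I ?\<sigma>" using \<tau>(1) by (auto simp: schedule_def jobs_def)
    show "represents I cs ?\<sigma>"
    proof -
      have "{l. (i, l) \<in> machines I \<and> machine_config I ?\<sigma> (i, l) = f} =
          {l. (i, l) \<in> machines I \<and> F (i, l) = f}" for i f
        using mc by auto
      then show ?thesis using wf F(1) by (simp add: represents_def)
    qed
  next
    fix y
    assume y: "y \<in> machines I"
    obtain r js where js: "(fst y, r, js) \<in> set cs" "F y = config_vector js"
      using F(2)[OF y] by auto
    have fibre: "{x \<in> jobs I. ?\<sigma> x = y} =
        (SIGMA j:{..<length (job_types I)}. {k. k < ?\<eta> j \<and> \<tau> j k = y})"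
      by (auto simp: jobs_def)
    have "(\<Sum>x\<in>{x \<in> jobs I. ?\<sigma> x = y}. ptime I x) =
        (\<Sum>j<length (job_types I). \<Sum>k\<in>{k. k < ?\<eta> j \<and> \<tau> j k = y}. fst (job_types I ! j))"
      unfolding fibre by (subst sum.Sigma) (auto simp: ptime_def split_def)
    also have "\<dots> = load I (F y)"
      using \<tau>(2)[OF _ y] by (auto simp: load_def intro!: sum.cong)
    finally show "\<exists>r js. (fst y, r, js) \<in> set cs \<and>
        completion_time I ?\<sigma> y = real (load I (config_vector js)) / real (speed I y)"
      using js by (auto simp: completion_time_def)
  qed
qed


section \<open>Total correctness of programs with a time bound\<close>

text \<open>Since \<open>exec\<close> is deterministic, the existence of a run is total correctness;
  the postcondition also sees its running time. There is no rule for \<open>Store\<close> below: the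
  program leaves the input in memory untouched.\<close>

definition wp :: "nat \<Rightarrow> prog \<Rightarrow> (nat \<Rightarrow> state \<Rightarrow> bool) \<Rightarrow> state \<Rightarrow> bool" where
  "wp w c Q s \<longleftrightarrow> (\<exists>t s'. exec w c s t s' \<and> Q t s')"

lemma wp_Skip [simp]: "wp w Skip Q s \<longleftrightarrow> Q 1 s"
  unfolding wp_def by (metis exec.Skip exec_SkipE)

lemma wp_Assign [simp]: "wp w (Assign r e) Q s \<longleftrightarrow>
    expr_fits w s e \<and> Q (expr_cost e + 1) (s\<lparr>regs := (regs s)(r := expr_val s e)\<rparr>)"
  unfolding wp_def by (metis exec.Assign exec_AssignE Suc_eq_plus1)

lemma wp_Write [simp]: "wp w (Write e) Q s \<longleftrightarrow>
    expr_fits w s e \<and> Q (expr_cost e + 1) (s\<lparr>out := out s @ [expr_val s e]\<rparr>)"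
  unfolding wp_def by (metis exec.Write exec_WriteE Suc_eq_plus1)

lemma wp_Seq [simp]: "wp w (Seq c1 c2) Q s \<longleftrightarrow> wp w c1 (\<lambda>t1. wp w c2 (\<lambda>t2. Q (t1 + t2))) s"
  unfolding wp_def by (metis exec.Seq exec_SeqE)

lemma wp_If [simp]: "wp w (If e c1 c2) Q s \<longleftrightarrow> expr_fits w s e \<and>
    (if expr_val s e \<noteq> 0 then wp w c1 (\<lambda>t. Q (expr_cost e + 1 + t)) s
     else wp w c2 (\<lambda>t. Q (expr_cost e + 1 + t)) s)"
  (is "?l \<longleftrightarrow> ?r")
proof
  assume ?l
  then show ?r unfolding wp_def by (auto elim!: exec_IfE)
next
  assume ?r
  then show ?l
    unfolding wp_def by (metis exec.IfTrue exec.IfFalse)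
qed

lemma wp_mono: "wp w c Q s \<Longrightarrow> (\<And>t s'. Q t s' \<Longrightarrow> R t s') \<Longrightarrow> wp w c R s"
  by (auto simp: wp_def)

text \<open>The measure bounds the number of iterations, and the \<open>Suc\<close> in the bound
  pays for the last, failing test.\<close>

lemma wp_While:
  fixes meas :: "state \<Rightarrow> nat"
  assumes "Inv s"
    and fits: "\<And>s. Inv s \<Longrightarrow> expr_fits w s e"
    and body: "\<And>s. Inv s \<Longrightarrow> expr_val s e \<noteq> 0 \<Longrightarrow>
      wp w c (\<lambda>t s'. Inv s' \<and> meas s' < meas s \<and> t \<le> D) s"
  shows "wp w (While e c) (\<lambda>t s'. Inv s' \<and> expr_val s' e = 0 \<and>
    t \<le> Suc (meas s) * (D + expr_cost e + 1)) s"
  using assms(1)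
proof (induction "meas s" arbitrary: s rule: less_induct)
  case less
  show ?case
  proof (cases "expr_val s e = 0")
    case True
    then show ?thesis
      using exec.WhileFalse[OF fits[OF less.prems] True] less.prems unfolding wp_def
      by (intro exI[of _ "expr_cost e + 1"] exI[of _ s]) auto
  next
    case False
    obtain t1 s1 where 1: "exec w c s t1 s1" "Inv s1" "meas s1 < meas s" "t1 \<le> D"
      using body[OF less.prems False] by (auto simp: wp_def)
    obtain t2 s2 where 2: "exec w (While e c) s1 t2 s2" "Inv s2" "expr_val s2 e = 0"
      "t2 \<le> Suc (meas s1) * (D + expr_cost e + 1)"
      using less.hyps[OF 1(3,2)] by (auto simp: wp_def)
    have "Suc (meas s1) * (D + expr_cost e + 1) \<le> meas s * (D + expr_cost e + 1)"
      using 1(3) by (intro mult_right_mono) auto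
    then have "expr_cost e + 1 + t1 + t2 \<le> Suc (meas s) * (D + expr_cost e + 1)"
      using 2(4) 1(4) by simp
    then show ?thesis
      using exec.WhileTrue[OF fits[OF less.prems] False 1(1) 2(1)] 2(2,3)
      unfolding wp_def by blast
  qed
qed


section \<open>The greedy algorithm\<close>

lemma used_append [simp]: "used (es @ es') j = used es j + used es' j"
  by (simp add: used_def)

lemma used_simps [simp]: "used [] j = 0"
  "used ((i, r, js) # es) j = r * config_vector js j + used es j"
  by (simp_all add: used_def)

lemma taken_append [simp]: "taken (es @ es') i = taken es i + taken es' i"
  by (simp add: taken_def)

lemma taken_simps [simp]: "taken [] i = 0"
  "taken ((i', r, js) # es) i = (if i' = i then r else 0) + taken es i"
  by (simp_all add: taken_def)

lemma config_vector_simps [simp]: "config_vector [] j = 0"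
  "config_vector ((j', c) # js) j = (if j' = j then c else config_vector js j)"
  by (simp_all add: config_vector_def)

text \<open>\<open>map_of\<close> finds the first pair of a type, so without freshness the appended
  pair would be hidden. The right-hand side is a sum of functions to match
  \<open>load_add\<close>.\<close>

lemma config_vector_snoc:
  assumes "j' \<notin> fst ` set js"
  shows "config_vector (js @ [(j', c)]) = (\<lambda>j. config_vector js j + (if j = j' then c else 0))"
  using assms by (induction js) (auto simp: image_iff fun_eq_iff)

lemma load_add: "load I (\<lambda>j. f j + g j) = load I f + load I g"
  by (simp add: load_def sum.distrib algebra_simps)

lemma load_single:
  "j' < length (job_types I) \<Longrightarrow>
    load I (\<lambda>j. if j = j' then c else 0) = fst (job_types I ! j') * c"
  by (simp add: load_def if_distrib cong: if_cong)

lemma load_Nil [simp]: "load I (config_vector []) = 0"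
  by (simp add: load_def)

lemma load_snoc:
  assumes "j \<notin> fst ` set js" "j < length (job_types I)"
  shows "load I (config_vector (js @ [(j, c)])) =
    load I (config_vector js) + fst (job_types I ! j) * c"
  unfolding config_vector_snoc[OF assms(1)] load_add load_single[OF assms(2)] ..

definition later :: "nat \<Rightarrow> (nat \<Rightarrow> nat) \<Rightarrow> nat \<Rightarrow> nat" where
  "later k v l = (if l \<le> k then 0 else v l)"

text \<open>
  The copies of type \<open>l\<close> that are left when \<open>x\<close> copies of the current type \<open>k\<close> are left. As
  \<open>later\<close> is a constant of its own, unfolding \<open>rest\<close> distinguishes only whether \<open>l = k\<close>.
\<close>

definition rest :: "nat \<Rightarrow> nat \<Rightarrow> (nat \<Rightarrow> nat) \<Rightarrow> nat \<Rightarrow> nat" where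
  "rest k x v l = (if l = k then x else later k v l)"

text \<open>Two views of the same stock: type \<open>k\<close> used up, or type \<open>Suc k\<close>
  current and untouched. Past the last type \<open>x\<close> is arbitrary, as the program then reads
  whatever stands at that address.\<close>

lemma rest_Suc:
  assumes "Suc k < N \<Longrightarrow> x = v (Suc k)" "l < N"
  shows "rest (Suc k) x v l = rest k 0 v l"
  using assms by (auto simp: rest_def later_def le_Suc_eq)

text \<open>Linearity of \<open>load\<close>: the loads of all machines add up to the processing
  time of the jobs placed, which can be compared with \<open>volume\<close>.\<close>

lemma sum_list_loads:
  "(\<Sum>(i, r, js)\<leftarrow>es. r * load I (config_vector js)) = load I (used es)"
proof (induction es)
  case (Cons en es)
  obtain i r js where [simp]: "en = (i, r, js)" by (cases en)
  have "load I (used (en # es)) = load I (\<lambda>j. r * config_vector js j + used es j)"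
    by (rule arg_cong[where f = "load I"]) auto
  then show ?case using Cons
    by (simp add: load_add) (simp add: load_def sum_distrib_left algebra_simps)
qed (simp add: used_def load_def)

text \<open>
  With \<open>cap i = \<lfloor>T s\<^sub>i\<rfloor>\<close>, an integral load exceeds \<open>T s\<^sub>i\<close> iff it is at least \<open>Suc (cap i)\<close>, so the
  assumption \<open>volume\<close> is a weak form of the volume bound.
\<close>

locale greedy =
  fixes I :: hm_instance and a b :: nat
  assumes valid: "hm_valid I" and b_pos: "b > 0"
    and volume: "(\<Sum>j<length (job_types I). fst (job_types I ! j) * snd (job_types I ! j)) \<le>
      (\<Sum>i<length (machine_types I). snd (machine_types I ! i) * Suc (a * fst (machine_types I ! i) div b))"
begin

abbreviation "n \<equiv> length (job_types I)"
abbreviation "m \<equiv> length (machine_types I)"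
abbreviation "p j \<equiv> fst (job_types I ! j)"
abbreviation "\<eta> j \<equiv> snd (job_types I ! j)"
abbreviation "s i \<equiv> fst (machine_types I ! i)"
abbreviation "\<mu> i \<equiv> snd (machine_types I ! i)"
abbreviation "cap i \<equiv> a * s i div b"

lemma pos: "j < n \<Longrightarrow> 0 < p j" "j < n \<Longrightarrow> 0 < \<eta> j" "i < m \<Longrightarrow> 0 < s i" "i < m \<Longrightarrow> 0 < \<mu> i"
  and nm_pos: "0 < n" "0 < m"
  using valid nth_mem[of j "job_types I"] nth_mem[of i "machine_types I"]
  by (auto simp: hm_valid_def split_beta)

lemma p_le_p_max: "j < n \<Longrightarrow> p j \<le> p_max I"
  by (simp add: p_max_def)

text \<open>The unfinished machine counts as an entry of multiplicity 1, so one formula covers the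
  totals with and without an open machine.\<close>

definition open_entry :: "nat \<Rightarrow> nat \<Rightarrow> (nat \<times> nat) list \<Rightarrow> config_entry list" where
  "open_entry i F js = (if F > 0 then [(i, 1, js)] else [])"

text \<open>
  Of job type \<open>j\<close> there are \<open>e\<close> jobs left, of machine type \<open>i\<close> there are \<open>u\<close> unopened machines
  left. An open machine has configuration \<open>js\<close> and \<open>F = Suc (cap i - load)\<close>, whereas \<open>F = 0\<close>
  means that no machine is open.
\<close>

definition inv :: "nat \<Rightarrow> nat \<Rightarrow> nat \<Rightarrow> nat \<Rightarrow> nat \<Rightarrow> config_entry list \<Rightarrow> (nat \<times> nat) list \<Rightarrow> bool" where
  "inv j e i u F cs js \<longleftrightarrow> j \<le> n \<and> i < m \<and>
    (\<forall>en \<in> set (cs @ open_entry i F js). wf_entry I en) \<and>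
    (\<forall>j'<n. used (cs @ open_entry i F js) j' +
      rest j e \<eta> j' = \<eta> j') \<and>
    (\<forall>i'<m. taken (cs @ open_entry i F js) i' +
      rest i u \<mu> i' = \<mu> i') \<and>
    (\<forall>(i', r, js') \<in> set cs. cap i' < load I (config_vector js') \<and>
      load I (config_vector js') \<le> cap i' + p_max I) \<and>
    (F > 0 \<longrightarrow> load I (config_vector js) + F = Suc (cap i) \<and>
      (\<forall>j' \<in> fst ` set js. j' \<le> j \<and> (j' = j \<longrightarrow> e = 0)))"

section \<open>Transitions of the invariant\<close>

lemma inv_init: "inv 0 (\<eta> 0) 0 (\<mu> 0) 0 [] []"
  using nm_pos by (simp add: inv_def rest_def later_def open_entry_def)

text \<open>The room left is \<open>F - 1\<close>, so \<open>c\<close> is the least number of jobs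
  of type \<open>j\<close> that overfills the machine, and the excess is at most
  \<open>p j\<close>.\<close>

lemma inv_close:
  assumes inv: "inv j e i u F cs js" and F: "F > 0" and j: "j < n"
    and c: "c = Suc ((F - 1) div p j)" "c \<le> e"
  shows "inv j (e - c) i u 0 (cs @ [(i, 1, js @ [(j, c)])]) []"
proof -
  \<comment> \<open>A type enters the open configuration only when it is used up, and here
    \<open>e > 0\<close>.\<close>
  have fresh: "j \<notin> fst ` set js" using inv F c by (auto simp: inv_def)
  have load: "load I (config_vector (js @ [(j, c)])) = load I (config_vector js) + p j * c"
    using fresh j by (rule load_snoc)
  have "F - 1 < p j * c"
    using dividend_less_times_div[of "p j" "F - 1"] pos(1)[OF j] by (simp add: c)
  moreover have "p j * c \<le> F - 1 + p j"
    by (simp add: c)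
  moreover have "load I (config_vector js) + F = Suc (cap i)" using inv F by (simp add: inv_def)
  ultimately have "cap i < load I (config_vector (js @ [(j, c)]))"
    "load I (config_vector (js @ [(j, c)])) \<le> cap i + p_max I"
    using load p_le_p_max[OF j] F by auto
  moreover have "wf_entry I (i, 1, js @ [(j, c)])"
    using inv F fresh j c by (auto simp: inv_def wf_entry_def open_entry_def)
  ultimately show ?thesis
    using inv F c by (auto simp: inv_def rest_def open_entry_def config_vector_snoc[OF fresh])
qed

text \<open>All remaining jobs of the type fit without exceeding the capacity, so the machine stays
  open and the type is finished.\<close>

lemma inv_place:
  assumes inv: "inv j e i u F cs js" and F: "F > 0" and j: "j < n"
    and e: "0 < e" "e \<le> (F - 1) div p j"
  shows "inv j 0 i u (F - e * p j) cs (js @ [(j, e)])" "F - e * p j > 0"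
proof -
  have fresh: "j \<notin> fst ` set js" using inv F e by (auto simp: inv_def)
  have load: "load I (config_vector (js @ [(j, e)])) = load I (config_vector js) + p j * e"
    using fresh j by (rule load_snoc)
  have "e * p j \<le> (F - 1) div p j * p j" using e by simp
  also have "\<dots> \<le> F - 1" by simp
  finally have le: "e * p j \<le> F - 1" .
  then show F': "F - e * p j > 0" using F by auto
  have "load I (config_vector js) + F = Suc (cap i)" using inv F by (simp add: inv_def)
  then have "load I (config_vector (js @ [(j, e)])) + (F - e * p j) = Suc (cap i)"
    using load le F by (simp add: mult.commute)
  moreover have "wf_entry I (i, 1, js @ [(j, e)])"
    using inv F fresh j e by (auto simp: inv_def wf_entry_def open_entry_def)
  ultimately show "inv j 0 i u (F - e * p j) cs (js @ [(j, e)])"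
    using inv F F' e by (auto simp: inv_def rest_def open_entry_def config_vector_snoc[OF fresh])
qed

text \<open>\<open>k\<close> is the least number of jobs of type \<open>j\<close> that overfills an
  empty machine; \<open>r\<close> such machines share one entry.\<close>

lemma inv_bulk:
  assumes inv: "inv j e i u 0 cs js" and j: "j < n"
    and k: "k = Suc (cap i div p j)" and r: "0 < r" "r \<le> u" "r * k \<le> e"
  shows "inv j (e - r * k) i (u - r) 0 (cs @ [(i, r, [(j, k)])]) []"
proof -
  have load: "load I (config_vector [(j, k)]) = p j * k"
    using load_snoc[of j "[]" I k] j by simp
  have "cap i < p j * k"
    using dividend_less_times_div[of "p j" "cap i"] pos(1)[OF j] by (simp add: k)
  moreover have "p j * k \<le> cap i + p j"
    by (simp add: k)
  ultimately have "cap i < load I (config_vector [(j, k)])"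
    "load I (config_vector [(j, k)]) \<le> cap i + p_max I"
    using load p_le_p_max[OF j] by auto
  moreover have "wf_entry I (i, r, [(j, k)])"
    using inv j k r by (auto simp: inv_def wf_entry_def)
  ultimately show ?thesis
    using inv r by (auto simp: inv_def rest_def open_entry_def)
qed

text \<open>The case left over by \<open>inv_bulk\<close>: too few jobs remain to overfill a
  machine, so all of them go to a new one, which stays open.\<close>

lemma inv_open:
  assumes inv: "inv j e i u 0 cs js" and j: "j < n" and u: "0 < u"
    and e: "0 < e" "e \<le> cap i div p j"
  shows "inv j 0 i (u - 1) (Suc (cap i) - e * p j) cs [(j, e)]" "Suc (cap i) - e * p j > 0"
proof -
  have load: "load I (config_vector [(j, e)]) = p j * e"
    using load_snoc[of j "[]" I e] j by simp
  have "e * p j \<le> cap i div p j * p j" using e by simp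
  also have "\<dots> \<le> cap i" by simp
  finally have le: "e * p j \<le> cap i" .
  then show F': "Suc (cap i) - e * p j > 0" by auto
  have "load I (config_vector [(j, e)]) + (Suc (cap i) - e * p j) = Suc (cap i)"
    using load le by (simp add: mult.commute)
  moreover have "wf_entry I (i, 1, [(j, e)])"
    using inv j e by (auto simp: inv_def wf_entry_def)
  ultimately show "inv j 0 i (u - 1) (Suc (cap i) - e * p j) cs [(j, e)]"
    using inv F' u e by (auto simp: inv_def rest_def open_entry_def)
qed

lemma inv_next_job:
  assumes inv: "inv j 0 i u F cs js" and j: "j < n" and e: "j + 1 < n \<Longrightarrow> e = \<eta> (j + 1)"
  shows "inv (j + 1) e i u F cs js"
  using inv j rest_Suc[of j n e \<eta>] e unfolding inv_def by (auto intro: order_trans)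

text \<open>The place where \<open>volume\<close> enters. If this were the last machine type, every
  machine would be overfull, and the jobs placed would amount to at least the sum of
  \<open>\<mu> i * Suc (cap i)\<close>; but type \<open>j\<close> has unplaced jobs, so the total
  processing time would be strictly larger.\<close>

lemma inv_next_machine:
  assumes inv: "inv j e i 0 0 cs js" and j: "j < n" and e: "0 < e"
  shows "i + 1 < m" "inv j e (i + 1) (\<mu> (i + 1)) 0 cs js"
proof -
  have cs: "used cs j' + rest j e \<eta> j' = \<eta> j'"
    if "j' < n" for j'
    using inv that by (auto simp: inv_def open_entry_def)
  show "i + 1 < m"
  proof (rule ccontr)
    assume "\<not> i + 1 < m"
    then have taken: "taken cs i' = \<mu> i'" if "i' < m" for i'
    proof -
      have "taken cs i' + rest i 0 \<mu> i' = \<mu> i'" "i' \<le> i"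
        using inv that \<open>\<not> i + 1 < m\<close> by (auto simp: inv_def open_entry_def)
      then show ?thesis by (auto simp: rest_def later_def split: if_splits)
    qed
    have "(\<Sum>i'<m. \<mu> i' * Suc (cap i')) = (\<Sum>i'<m. taken cs i' * Suc (cap i'))"
      using taken by simp
    also have "\<dots> = (\<Sum>(i', r, js)\<leftarrow>cs. r * Suc (cap i'))"
    proof -
      have "\<forall>en\<in>set cs. fst en < m" using inv by (auto simp: inv_def wf_entry_def)
      then show ?thesis
        by (induction cs) (auto simp: add_mult_distrib sum.distrib if_distrib[where f = "\<lambda>x. x * _"] cong: if_cong)
    qed
    also have "\<dots> \<le> (\<Sum>(i', r, js)\<leftarrow>cs. r * load I (config_vector js))"
    proof (rule sum_list_mono)
      fix en
      assume "en \<in> set cs"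
      then show "(case en of (i', r, js) \<Rightarrow> r * Suc (cap i')) \<le>
          (case en of (i', r, js) \<Rightarrow> r * load I (config_vector js))"
        using inv by (auto simp: inv_def simp del: mult_Suc_right intro!: mult_left_mono Suc_leI)
    qed
    also have "\<dots> = load I (used cs)"
      by (rule sum_list_loads)
    also have "\<dots> = (\<Sum>j'<n. p j' * used cs j')"
      by (simp add: load_def)
    also have "\<dots> < (\<Sum>j'<n. p j' * \<eta> j')"
    proof (rule sum_strict_mono_strong[of _ j])
      show "p j' * used cs j' \<le> p j' * \<eta> j'" if "j' \<in> {..<n}" for j'
        using cs[of j'] that by simp
      show "p j * used cs j < p j * \<eta> j"
        using cs[OF j] e pos(1)[OF j] by (simp add: rest_def)
    qed (use j in auto)
    finally show False using volume by simp
  qed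
  then show "inv j e (i + 1) (\<mu> (i + 1)) 0 cs js"
    using inv rest_Suc[of i m "\<mu> (i + 1)" \<mu>] by (auto simp: inv_def open_entry_def)
qed

text \<open>When all jobs are placed, only upper bounds on the loads are kept: the machine left open
  and the empty machines need not be overfull.\<close>

definition final_inv :: "nat \<Rightarrow> nat \<Rightarrow> config_entry list \<Rightarrow> bool" where
  "final_inv i u cs \<longleftrightarrow> i \<le> m \<and>
    (\<forall>en \<in> set cs. wf_entry I en) \<and>
    (\<forall>j'<n. used cs j' = \<eta> j') \<and>
    (\<forall>i'<m. taken cs i' + rest i u \<mu> i' = \<mu> i') \<and>
    (\<forall>(i', r, js') \<in> set cs. load I (config_vector js') \<le> cap i' + p_max I)"

lemma inv_imp_final_inv:
  assumes "inv n e i u F cs js"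
  shows "final_inv i u (cs @ open_entry i F js)"
  using assms p_le_p_max by (fastforce simp: inv_def final_inv_def open_entry_def rest_def later_def)

text \<open>Machines without jobs must be listed too, but \<open>wf_entry\<close> forbids
  multiplicity 0, hence the case distinction.\<close>

lemma final_inv_empty:
  assumes "final_inv i u cs" "i < m" "i + 1 < m \<Longrightarrow> u' = \<mu> (i + 1)"
  shows "final_inv (i + 1) u' (if u > 0 then cs @ [(i, u, [])] else cs)"
proof -
  have "final_inv i 0 (if u > 0 then cs @ [(i, u, [])] else cs)"
    using assms(1,2) by (auto simp: final_inv_def wf_entry_def rest_def)
  then show ?thesis
    using assms(2) rest_Suc[of i m u' \<mu>] assms(3) by (auto simp: final_inv_def)
qed

lemma final_inv_schedule:
  assumes "final_inv m u cs"
  obtains \<sigma> where "schedule I \<sigma>" "represents I cs \<sigma>"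
    "makespan I \<sigma> \<le> real a / real b + real (p_max I)"
proof -
  have "\<exists>\<sigma>. schedule I \<sigma> \<and> represents I cs \<sigma> \<and>
    (\<forall>y\<in>machines I. \<exists>r js. (fst y, r, js) \<in> set cs \<and>
      completion_time I \<sigma> y = real (load I (config_vector js)) / real (speed I y))"
    by (rule ex_schedule) (use assms in \<open>auto simp: final_inv_def rest_def later_def\<close>)
  then obtain \<sigma> where \<sigma>: "schedule I \<sigma>" "represents I cs \<sigma>"
    "\<forall>y\<in>machines I. \<exists>r js. (fst y, r, js) \<in> set cs \<and>
      completion_time I \<sigma> y = real (load I (config_vector js)) / real (speed I y)"
    by blast
  have "completion_time I \<sigma> y \<le> real a / real b + real (p_max I)" if y: "y \<in> machines I" for y
  proof -
    obtain r js where js: "(fst y, r, js) \<in> set cs"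
      "completion_time I \<sigma> y = real (load I (config_vector js)) / real (speed I y)"
      using \<sigma>(3) y by blast
    have "fst y < m" using y by (auto simp: machines_def)
    then have s: "real (speed I y) \<ge> 1" using pos(3)[of "fst y"] by (simp add: speed_def)
    have "load I (config_vector js) \<le> cap (fst y) + p_max I"
      using assms js(1) by (auto simp: final_inv_def)
    then have "real (load I (config_vector js)) \<le> real (a * speed I y div b) + real (p_max I)"
      by (simp add: speed_def flip: of_nat_add)
    also have "\<dots> \<le> real a * real (speed I y) / real b + real (p_max I) * real (speed I y)"
      using s of_nat_div_le_of_nat[of "a * speed I y" b, where ?'a = real]
        mult_left_mono[OF s, of "real (p_max I)"] by simp
    also have "\<dots> = (real a / real b + real (p_max I)) * real (speed I y)"
      by (simp add: algebra_simps)
    finally show ?thesis using s by (simp add: js(2) divide_le_eq)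
  qed
  moreover have "machines I \<noteq> {}"
    using nm_pos(2) pos(4)[of 0] by (auto simp: machines_def)
  ultimately have "makespan I \<sigma> \<le> real a / real b + real (p_max I)"
    by (simp add: makespan_def finite_machines)
  then show ?thesis using \<sigma>(1,2) that by blast
qed

end


section \<open>The word RAM program\<close>

lemma wp_SeqI:
  assumes "wp w c1 R s" "\<And>t1 s1. R t1 s1 \<Longrightarrow> wp w c2 (\<lambda>t2. Q (t1 + t2)) s1"
  shows "wp w (Seq c1 c2) Q s"
  using wp_mono[OF assms] by simp

text \<open>
  Registers 0 to 4 hold \<open>j\<close>, \<open>e\<close>, \<open>i\<close>, \<open>u\<close> and \<open>F\<close> of the invariant, registers 5 and 6 the
  processing time \<open>p j\<close> and the capacity \<open>cap i\<close>.
\<close>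

definition "p_expr = Mem (Bin Add (Const 4) (Bin Mul (Const 2) (Reg 0)))"
definition "eta_expr = Mem (Bin Add (Const 5) (Bin Mul (Const 2) (Reg 0)))"
text \<open>Four header cells and the \<open>n\<close> job pairs precede the machine pairs; cell 0
  holds \<open>n\<close>.\<close>

definition "s_expr = Mem (Bin Add (Const 4) (Bin Mul (Const 2) (Bin Add (Mem (Const 0)) (Reg 2))))"
definition "mu_expr = Mem (Bin Add (Const 5) (Bin Mul (Const 2) (Bin Add (Mem (Const 0)) (Reg 2))))"

primrec seq :: "prog list \<Rightarrow> prog" where
  "seq [] = Skip"
| "seq (c # cs) = Seq c (seq cs)"

definition "fetch = seq
  [Assign 5 p_expr,
   Assign 6 (Bin Div (Bin Mul (Mem (Const 2)) s_expr) (Mem (Const 3)))]"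

text \<open>Register 7 holds the \<open>c\<close> of \<open>inv_close\<close>. The truncated
  difference is nonzero iff \<open>e < c\<close>, that is, iff the remaining jobs all fit.\<close>

definition "fill_open = seq
  [Assign 7 (Bin Add (Bin Div (Bin Sub (Reg 4) (Const 1)) (Reg 5)) (Const 1)),
   If (Bin Sub (Reg 7) (Reg 1))
     (seq [Write (Reg 1), Write (Reg 0),
       Assign 4 (Bin Sub (Reg 4) (Bin Mul (Reg 1) (Reg 5))), Assign 1 (Const 0)])
     (seq [Write (Reg 7), Write (Reg 0), Write (Const 0),
       Assign 1 (Bin Sub (Reg 1) (Reg 7)), Assign 4 (Const 0)])]"

text \<open>Registers 7 and 8 hold \<open>k\<close> and \<open>r\<close> of \<open>inv_bulk\<close>,
  with \<open>r\<close> the minimum of \<open>e div k\<close> and \<open>u\<close>.\<close>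

definition "bulk = seq
  [Assign 7 (Bin Add (Bin Div (Reg 6) (Reg 5)) (Const 1)),
   Assign 8 (Bin Div (Reg 1) (Reg 7)),
   If (Bin Sub (Reg 8) (Reg 3)) (Assign 8 (Reg 3)) Skip,
   If (Reg 8)
     (seq [Write (Reg 2), Write (Reg 8), Write (Reg 7), Write (Reg 0), Write (Const 0),
       Assign 1 (Bin Sub (Reg 1) (Bin Mul (Reg 8) (Reg 7))),
       Assign 3 (Bin Sub (Reg 3) (Reg 8))])
     Skip]"

definition "open_new = If (Reg 1) (If (Reg 3)
  (seq [Write (Reg 2), Write (Const 1), Write (Reg 1), Write (Reg 0),
    Assign 3 (Bin Sub (Reg 3) (Const 1)),
    Assign 4 (Bin Sub (Bin Add (Reg 6) (Const 1)) (Bin Mul (Reg 1) (Reg 5))),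
    Assign 1 (Const 0)]) Skip) Skip"

text \<open>When this is reached with \<open>e > 0\<close>, the machine type is used up and no
  machine is open. Exactly one index grows per round, which bounds the number of rounds.\<close>

definition "advance = If (Reg 1)
  (seq [Assign 2 (Bin Add (Reg 2) (Const 1)), Assign 3 mu_expr])
  (seq [Assign 0 (Bin Add (Reg 0) (Const 1)), Assign 1 eta_expr])"

text \<open>A machine still open after \<open>fill_open\<close> means that the current job type is
  used up, hence the \<open>Skip\<close>.\<close>

definition "greedy_step =
  Seq fetch (Seq (If (Reg 4) fill_open Skip)
    (Seq (If (Reg 4) Skip (Seq bulk open_new)) advance))"

definition "emit_empty = seq
  [If (Reg 3) (seq [Write (Reg 2), Write (Reg 3), Write (Const 0)]) Skip,
   Assign 2 (Bin Add (Reg 2) (Const 1)), Assign 3 mu_expr]"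

definition "greedy_prog =
  Seq (seq [Assign 1 eta_expr, Assign 3 mu_expr])
  (Seq (While (Bin Sub (Mem (Const 0)) (Reg 0)) greedy_step)
  (Seq (If (Reg 4) (Write (Const 0)) Skip)
    (While (Bin Sub (Mem (Const 1)) (Reg 2)) emit_empty)))"

section \<open>Output format, input layout and word size\<close>

lemma encode_configs_append [simp]: "encode_configs (cs @ cs') = encode_configs cs @ encode_configs cs'"
  by (simp add: encode_configs_def)

lemma encode_configs_simps [simp]: "encode_configs [] = []"
  "encode_configs ((i, r, js) # cs) =
    i # r # concat (map (\<lambda>(j, c). [c, j]) js) @ 0 # encode_configs cs"
  by (simp_all add: encode_configs_def encode_entry_def)

lemma concat_pairs_nth:
  assumes "k < length xs"
  shows "concat (map (\<lambda>(x, y). [x, y]) xs) ! (2 * k) = fst (xs ! k)"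
    "concat (map (\<lambda>(x, y). [x, y]) xs) ! Suc (2 * k) = snd (xs ! k)"
  using assms by (induction xs arbitrary: k) (auto simp: nth_Cons split: nat.split)

lemma length_concat_pairs: "length (concat (map (\<lambda>(x, y). [x, y]) xs)) = 2 * length xs"
  by (induction xs) auto

context greedy
begin

definition inp :: "nat \<Rightarrow> nat" where
  "inp = mem (init_state (input I a b))"

definition bound :: nat where
  "bound = 2 ^ word_bits (input I a b)"

text \<open>\<open>2 ^ w\<close> is the cube of \<open>bound\<close>. Products such as
  \<open>a * s i\<close> and \<open>e * p j\<close> stay below the square; the third factor gives
  slack, so that weak inequalities suffice.\<close>

definition w :: nat where
  "w = 3 * word_bits (input I a b)"

lemma length_input: "length (input I a b) = 4 + 2 * (n + m)"
  by (simp add: input_def hm_numbers_def length_concat_pairs del: map_append)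

lemma inp_simps: "inp 0 = n" "inp (Suc 0) = m" "inp 2 = a" "inp 3 = b"
  "j < n \<Longrightarrow> inp (4 + 2 * j) = p j" "j < n \<Longrightarrow> inp (5 + 2 * j) = \<eta> j"
  "i < m \<Longrightarrow> inp (4 + 2 * (n + i)) = s i" "i < m \<Longrightarrow> inp (5 + 2 * (n + i)) = \<mu> i"
proof -
  have inp: "inp k = input I a b ! k" if "k < 4 + 2 * (n + m)" for k
    using that by (simp add: inp_def init_state_def length_input)
  show "inp 0 = n" "inp (Suc 0) = m" "inp 2 = a" "inp 3 = b"
    by (simp_all add: inp) (simp_all add: input_def)
  have nth: "inp (4 + 2 * k) = fst ((job_types I @ machine_types I) ! k)"
    "inp (5 + 2 * k) = snd ((job_types I @ machine_types I) ! k)" if "k < n + m" for k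
  proof -
    have "input I a b ! (4 + l) = hm_numbers I ! l" for l
      by (simp add: input_def eval_nat_numeral)
    from this[of "2 * k"] this[of "Suc (2 * k)"]
    show "inp (4 + 2 * k) = fst ((job_types I @ machine_types I) ! k)"
      "inp (5 + 2 * k) = snd ((job_types I @ machine_types I) ! k)"
      using that concat_pairs_nth[of k "job_types I @ machine_types I"]
      by (simp_all add: inp hm_numbers_def del: map_append concat_append)
  qed
  show "j < n \<Longrightarrow> inp (4 + 2 * j) = p j" "j < n \<Longrightarrow> inp (5 + 2 * j) = \<eta> j"
    "i < m \<Longrightarrow> inp (4 + 2 * (n + i)) = s i" "i < m \<Longrightarrow> inp (5 + 2 * (n + i)) = \<mu> i"
    using nth[of j] nth[of "n + i"] by (simp_all add: nth_append)
qed

lemma word_bound: "x \<in> insert (length (input I a b)) (set (input I a b)) \<Longrightarrow> x < bound"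
proof -
  let ?M = "Max (insert (length (input I a b)) (set (input I a b)))"
  assume "x \<in> insert (length (input I a b)) (set (input I a b))"
  then have "x \<le> ?M" by (intro Max_ge) auto
  also have "?M < bound"
    using floorlog_bounds[of ?M 2]
    by (cases "?M = 0") (auto simp: bound_def word_bits_def)
  finally show ?thesis .
qed

lemma length_bound: "4 + 2 * (n + m) < bound"
  using word_bound[of "length (input I a b)"] by (simp add: length_input)

lemma inp_bound: "inp k < bound"
proof (cases "k < length (input I a b)")
  case True
  then show ?thesis using word_bound[of "input I a b ! k"] by (simp add: inp_def init_state_def)
next
  case False
  then show ?thesis using length_bound by (simp add: inp_def init_state_def)
qed

lemma fits: "x \<le> bound * bound \<Longrightarrow> x < 2 ^ w"
proof -
  assume "x \<le> bound * bound"
  also have "\<dots> < bound * bound * bound"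
    using length_bound by simp
  also have "\<dots> = 2 ^ w"
    by (simp add: bound_def w_def flip: power_add)
  finally show ?thesis .
qed

lemma fits_bound: "x < bound \<Longrightarrow> x < 2 ^ w"
  using fits[of x] le_square[of bound] by linarith

lemma fits_mult: "x < bound \<Longrightarrow> y < bound \<Longrightarrow> x * y < 2 ^ w"
  by (intro fits mult_mono) auto

lemma data_bounds: "a < bound" "b < bound" "j < n \<Longrightarrow> p j < bound" "j < n \<Longrightarrow> \<eta> j < bound"
  "i < m \<Longrightarrow> s i < bound" "i < m \<Longrightarrow> \<mu> i < bound"
  by (metis inp_simps inp_bound)+

lemma Suc_cap_le: "i < m \<Longrightarrow> Suc (cap i) \<le> bound * bound"
proof -
  assume i: "i < m"
  have "cap i \<le> a * s i" by simp
  also have "\<dots> < bound * bound"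
    using data_bounds(1) data_bounds(5)[OF i] by (intro mult_strict_mono) auto
  finally show ?thesis by simp
qed

lemma inv_bounds:
  assumes "inv j e i u F cs js"
  shows "j < bound" "i < bound" "u < bound" "j < n \<Longrightarrow> e < bound" "F \<le> bound * bound" "i < m"
proof -
  show i: "i < m" and "j < bound" "i < bound"
    using assms length_bound by (auto simp: inv_def)
  have "u \<le> \<mu> i" using assms i by (auto simp: inv_def rest_def)
  then show "u < bound" using data_bounds(6)[OF i] by simp
  show "e < bound" if "j < n"
  proof -
    have "e \<le> \<eta> j" using assms that by (auto simp: inv_def rest_def)
    then show ?thesis using data_bounds(4)[OF that] by simp
  qed
  have "F \<le> Suc (cap i)" using assms by (auto simp: inv_def)
  then show "F \<le> bound * bound" using Suc_cap_le[OF i] by simp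
qed

lemma numeral_fits: "0 < w" "2 < (2::nat) ^ w" "3 < (2::nat) ^ w" "4 < (2::nat) ^ w" "5 < (2::nat) ^ w"
proof -
  have "5 < bound" using length_bound nm_pos by (cases n; cases m) auto
  then show "0 < w"
    by (auto simp: bound_def w_def intro: gr0I)
  show "2 < (2::nat) ^ w" "3 < (2::nat) ^ w" "4 < (2::nat) ^ w" "5 < (2::nat) ^ w"
    using \<open>5 < bound\<close> by (auto intro!: fits_bound)
qed


lemma expr_costs:
  "expr_cost p_expr = 6" "expr_cost eta_expr = 6" "expr_cost s_expr = 9" "expr_cost mu_expr = 9"
  by (simp_all add: p_expr_def eta_expr_def s_expr_def mu_expr_def)

text \<open>The index \<open>n\<close> is allowed because \<open>advance\<close> still reads
  \<open>eta_expr\<close> after the last job type: the value is then arbitrary, but it and its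
  address must fit into a word. \<open>machine_exprs\<close> allows \<open>m\<close> likewise, for
  \<open>emit_empty\<close>.\<close>

lemma job_exprs:
  assumes "mem st = inp" "regs st 0 \<le> n"
  shows "expr_fits w st p_expr" "expr_fits w st eta_expr"
    "regs st 0 < n \<Longrightarrow> expr_val st p_expr = p (regs st 0)"
    "regs st 0 < n \<Longrightarrow> expr_val st eta_expr = \<eta> (regs st 0)"
proof -
  have fit: "regs st 0 < 2 ^ w" "2 * regs st 0 < 2 ^ w" "4 + 2 * regs st 0 < 2 ^ w"
    "inp k < 2 ^ w" for k
    using length_bound assms(2) nm_pos inp_bound by (auto intro!: fits_bound)
  have "5 + 2 * regs st 0 \<le> bound"
    using length_bound assms(2) by simp
  then have "5 + 2 * regs st 0 < 2 ^ w"
    by (intro fits) (rule order_trans[OF _ le_square])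
  then show "expr_fits w st p_expr" "expr_fits w st eta_expr"
    using fit numeral_fits by (simp_all add: p_expr_def eta_expr_def assms(1))
  show "regs st 0 < n \<Longrightarrow> expr_val st p_expr = p (regs st 0)"
    "regs st 0 < n \<Longrightarrow> expr_val st eta_expr = \<eta> (regs st 0)"
    using inp_simps(5,6) by (simp_all add: p_expr_def eta_expr_def assms(1))
qed

lemma machine_exprs:
  assumes "mem st = inp" "regs st 2 \<le> m"
  shows "expr_fits w st s_expr" "expr_fits w st mu_expr"
    "regs st 2 < m \<Longrightarrow> expr_val st s_expr = s (regs st 2)"
    "regs st 2 < m \<Longrightarrow> expr_val st mu_expr = \<mu> (regs st 2)"
proof -
  have fit: "n < 2 ^ w" "regs st 2 < 2 ^ w" "n + regs st 2 < 2 ^ w" "2 * (n + regs st 2) < 2 ^ w"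
    "4 + 2 * (n + regs st 2) < 2 ^ w" "inp k < 2 ^ w" for k
    using length_bound assms(2) inp_bound by (auto intro!: fits_bound)
  \<comment> \<open>For index \<open>m\<close> the address lies past the input, and
    \<open>length_bound\<close> yields only a weak inequality, hence \<open>fits\<close> instead of
    \<open>fits_bound\<close>.\<close>
  have "5 + 2 * (n + regs st 2) \<le> bound"
    using length_bound assms(2) by simp
  then have "5 + 2 * (n + regs st 2) < 2 ^ w"
    by (intro fits) (rule order_trans[OF _ le_square])
  then show "expr_fits w st s_expr" "expr_fits w st mu_expr"
    using fit numeral_fits inp_simps(1) by (simp_all add: s_expr_def mu_expr_def assms(1))
  show "regs st 2 < m \<Longrightarrow> expr_val st s_expr = s (regs st 2)"
    "regs st 2 < m \<Longrightarrow> expr_val st mu_expr = \<mu> (regs st 2)"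
    using inp_simps(1,7,8) by (simp_all add: s_expr_def mu_expr_def assms(1))
qed

text \<open>Hides the lists of the invariant behind the output written so far. The entry of an open
  machine is already there except for its final 0.\<close>

definition trace :: "nat \<Rightarrow> nat \<Rightarrow> nat \<Rightarrow> nat \<Rightarrow> nat \<Rightarrow> nat list \<Rightarrow> bool" where
  "trace j e i u F os \<longleftrightarrow> (\<exists>cs js. inv j e i u F cs js \<and> os = encode_configs cs @
    (if F > 0 then i # 1 # concat (map (\<lambda>(j, c). [c, j]) js) else []))"

section \<open>The transitions as seen in the output\<close>

lemma trace_init: "trace 0 (\<eta> 0) 0 (\<mu> 0) 0 []"
  using inv_init by (auto simp: trace_def)

lemma trace_close:
  assumes "trace j e i u F os" "F > 0" "j < n" "c = Suc ((F - 1) div p j)" "c \<le> e"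
  shows "trace j (e - c) i u 0 (os @ [c, j, 0])"
proof -
  obtain cs js where "inv j e i u F cs js"
    "os = encode_configs cs @ i # 1 # concat (map (\<lambda>(j, c). [c, j]) js)"
    using assms(1,2) by (auto simp: trace_def)
  then show ?thesis
    using inv_close[OF _ assms(2-5), of i u cs js]
    by (auto simp: trace_def intro!: exI[of _ "cs @ [(i, 1, js @ [(j, c)])]"])
qed

lemma trace_place:
  assumes "trace j e i u F os" "F > 0" "j < n" "0 < e" "e \<le> (F - 1) div p j"
  shows "trace j 0 i u (F - e * p j) (os @ [e, j])"
proof -
  obtain cs js where "inv j e i u F cs js"
    "os = encode_configs cs @ i # 1 # concat (map (\<lambda>(j, c). [c, j]) js)"
    using assms(1,2) by (auto simp: trace_def)
  then show ?thesis
    using inv_place[OF _ assms(2-5), of i u cs js]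
    by (auto simp: trace_def intro!: exI[of _ cs] exI[of _ "js @ [(j, e)]"])
qed

lemma trace_bulk:
  assumes "trace j e i u 0 os" "j < n" "k = Suc (cap i div p j)" "0 < r" "r \<le> u" "r * k \<le> e"
  shows "trace j (e - r * k) i (u - r) 0 (os @ [i, r, k, j, 0])"
proof -
  obtain cs js where "inv j e i u 0 cs js" "os = encode_configs cs"
    using assms(1) by (auto simp: trace_def)
  then show ?thesis
    using inv_bulk[OF _ assms(2-6), of cs js]
    by (auto simp: trace_def intro!: exI[of _ "cs @ [(i, r, [(j, k)])]"])
qed

lemma trace_open:
  assumes "trace j e i u 0 os" "j < n" "0 < u" "0 < e" "e \<le> cap i div p j"
  shows "trace j 0 i (u - 1) (Suc (cap i) - e * p j) (os @ [i, 1, e, j])"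
proof -
  obtain cs js where "inv j e i u 0 cs js" "os = encode_configs cs"
    using assms(1) by (auto simp: trace_def)
  then show ?thesis
    using inv_open[OF _ assms(2-5), of cs js]
    by (auto simp: trace_def intro!: exI[of _ cs] exI[of _ "[(j, e)]"])
qed

lemma trace_next_job:
  assumes "trace j 0 i u F os" "j < n" "j + 1 < n \<Longrightarrow> e = \<eta> (j + 1)"
  shows "trace (j + 1) e i u F os"
  using assms(1) inv_next_job[OF _ assms(2,3)] unfolding trace_def by blast

lemma trace_next_machine:
  assumes "trace j e i 0 0 os" "j < n" "0 < e"
  shows "i + 1 < m" "trace j e (i + 1) (\<mu> (i + 1)) 0 os"
proof -
  obtain cs js where inv: "inv j e i 0 0 cs js" "os = encode_configs cs"
    using assms(1) by (auto simp: trace_def)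
  show "i + 1 < m" "trace j e (i + 1) (\<mu> (i + 1)) 0 os"
    using inv_next_machine[OF inv(1) assms(2,3)] inv(2) by (auto simp: trace_def)
qed

lemma trace_bounds:
  assumes "trace j e i u F os"
  shows "j < bound" "i < bound" "u < bound" "j < n \<Longrightarrow> e < bound" "F \<le> bound * bound" "i < m" "j \<le> n"
proof -
  obtain cs js where inv: "inv j e i u F cs js"
    using assms by (auto simp: trace_def)
  show "j < bound" "i < bound" "u < bound" "j < n \<Longrightarrow> e < bound" "F \<le> bound * bound" "i < m" "j \<le> n"
    using inv_bounds[OF inv] inv by (auto simp: inv_def)
qed

definition good :: "state \<Rightarrow> bool" where
  "good st \<longleftrightarrow> mem st = inp \<and>
    trace (regs st 0) (regs st 1) (regs st 2) (regs st 3) (regs st 4) (out st)"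

section \<open>Specifications of the program blocks\<close>

lemma fetch_spec:
  assumes good: "good st" and j: "regs st 0 < n"
  shows "wp w fetch (\<lambda>t st'. good st' \<and> regs st' 0 = regs st 0 \<and> regs st' 1 = regs st 1 \<and>
    regs st' 2 = regs st 2 \<and> regs st' 3 = regs st 3 \<and> regs st' 4 = regs st 4 \<and>
    regs st' 5 = p (regs st 0) \<and> regs st' 6 = cap (regs st 2) \<and> t \<le> 50) st"
proof -
  let ?st = "st\<lparr>regs := (regs st)(5 := expr_val st p_expr)\<rparr>"
  have mem: "mem st = inp" "mem ?st = inp" using good by (simp_all add: good_def)
  note bnd = trace_bounds[OF conjunct2[OF good[unfolded good_def]]]
  have "regs ?st 2 \<le> m" using bnd(6) by simp
  note job = job_exprs[OF mem(1)] and machine = machine_exprs[OF mem(2) this]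
  have fit: "a * s (regs st 2) < 2 ^ w" "cap (regs st 2) < 2 ^ w" "a < 2 ^ w" "b < 2 ^ w"
    using data_bounds(1,2) data_bounds(5)[OF bnd(6)] Suc_cap_le[OF bnd(6)]
    by (auto intro: fits fits_mult fits_bound)
  show ?thesis
    using good fit numeral_fits job machine j bnd(6) inp_simps(1-4)
    by (simp add: fetch_def mem good_def expr_costs)
qed

lemma fill_open_spec:
  assumes good: "good st" and j: "regs st 0 < n" and e: "regs st 1 > 0" and F: "regs st 4 > 0"
    and p: "regs st 5 = p (regs st 0)"
  shows "wp w fill_open (\<lambda>t st'. good st' \<and> regs st' 0 = regs st 0 \<and> regs st' 2 = regs st 2 \<and>
    regs st' 5 = regs st 5 \<and> regs st' 6 = regs st 6 \<and> (regs st' 1 = 0 \<or> regs st' 4 = 0) \<and> t \<le> 50) st"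
proof -
  define j e i u F where "j = regs st 0" "e = regs st (Suc 0)" "i = regs st 2" "u = regs st 3" "F = regs st 4"
  note regs = this
  have trace: "trace j e i u F (out st)" and mem: "mem st = inp"
    using good by (simp_all add: good_def regs)
  note bnd = trace_bounds[OF trace]
  have jn: "j < n" "0 < e" "0 < F" using j e F by (simp_all add: regs)
  have p5: "regs st 5 = p j" using p by (simp add: regs)
  let ?k = "Suc ((F - Suc 0) div p j)"
  have le: "(F - Suc 0) div p j \<le> F - Suc 0" by (rule div_le_dividend)
  then have k: "?k \<le> F" using jn(3) by linarith
  have fit: "F < 2 ^ w" "F - Suc 0 < 2 ^ w" "(F - Suc 0) div p j < 2 ^ w" "?k < 2 ^ w" "e < 2 ^ w"
    "j < 2 ^ w" "p j < 2 ^ w" "e * p j < 2 ^ w" "?k - e < 2 ^ w" "e - ?k < 2 ^ w" "F - e * p j < 2 ^ w"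
    using k bnd jn data_bounds(3)[OF jn(1)] order_trans[OF le]
    by (auto intro: fits fits_bound fits_mult less_imp_diff_less)
  show ?thesis
  proof (cases "?k \<le> e")
    case True
    have "trace j (e - ?k) i u 0 (out st @ [?k, j, 0])"
      using trace_close[OF trace jn(3,1) _ True] by simp
    then show ?thesis
      using True fit numeral_fits jn
      by (simp add: fill_open_def good_def mem p5 flip: regs)
  next
    case False
    have "trace j 0 i u (F - e * p j) (out st @ [e, j])"
      using trace_place[OF trace jn(3,1,2)] False by simp
    then show ?thesis
      using False fit numeral_fits jn
      by (simp add: fill_open_def good_def mem p5 flip: regs)
  qed
qed

text \<open>Unless the machines run out, \<open>r = e div k\<close> and the remainder
  \<open>e mod k < k\<close> is left. It fits on one machine, as \<open>open_new_spec\<close>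
  requires.\<close>

lemma bulk_spec:
  assumes good: "good st" and j: "regs st 0 < n" and F: "regs st 4 = 0"
    and p: "regs st 5 = p (regs st 0)" "regs st 6 = cap (regs st 2)"
  shows "wp w bulk (\<lambda>t st'. good st' \<and> regs st' 0 = regs st 0 \<and> regs st' 2 = regs st 2 \<and>
    regs st' 4 = 0 \<and> regs st' 5 = regs st 5 \<and> regs st' 6 = regs st 6 \<and>
    (regs st' 3 = 0 \<or> regs st' 1 \<le> cap (regs st 2) div p (regs st 0)) \<and> t \<le> 50) st"
proof -
  define j e i u where "j = regs st 0" "e = regs st (Suc 0)" "i = regs st 2" "u = regs st 3"
  note regs = this
  have trace: "trace j e i u 0 (out st)" and mem: "mem st = inp"
    using good F by (simp_all add: good_def regs)
  note bnd = trace_bounds[OF trace]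
  have jn: "j < n" using j by (simp add: regs)
  have p5: "regs st 5 = p j" "regs st 6 = cap i" using p by (simp_all add: regs)
  let ?k = "Suc (cap i div p j)"
  let ?r = "e div ?k"
  have le: "cap i div p j \<le> cap i" by (rule div_le_dividend)
  have k: "?k \<le> bound * bound" using Suc_cap_le[OF bnd(6)] le by linarith
  have mult: "r * ?k \<le> e" if "r \<le> ?r" for r
    using that by (metis div_times_less_eq_dividend mult_le_mono1 order_trans)
  have fit: "cap i < 2 ^ w" "cap i div p j < 2 ^ w" "?k < 2 ^ w" "e < 2 ^ w" "?r < 2 ^ w"
    "i < 2 ^ w" "j < 2 ^ w" "p j < 2 ^ w" "u < 2 ^ w" "?r - u < 2 ^ w"
    using k bnd jn data_bounds(3)[OF jn] Suc_cap_le[OF bnd(6)] le_less_trans[OF div_le_dividend[of e ?k]]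
    by (auto intro: fits fits_bound less_imp_diff_less)
  \<comment> \<open>The terms \<open>r + r * (cap i div p j)\<close> are \<open>r * ?k\<close> with
    the \<open>Suc\<close> multiplied out.\<close>
  have fit_r: "r \<le> ?r \<Longrightarrow> r + r * (cap i div p j) < 2 ^ w"
    "r \<le> ?r \<Longrightarrow> e - (r + r * (cap i div p j)) < 2 ^ w" "u - r < 2 ^ w" for r
    using bnd jn le_less_trans[OF mult[of r]]
    by (auto intro: fits_bound less_imp_diff_less)
  have bulk: "trace j (e - (r + r * (cap i div p j))) i (u - r) 0 (out st @ [i, r, ?k, j, 0])"
    if "0 < r" "r \<le> u" "r \<le> ?r" for r
    using trace_bulk[OF trace jn refl that(1,2) mult[OF that(3)]] by simp
  have rem: "e - (?r + ?r * (cap i div p j)) \<le> cap i div p j"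
    using mod_less_divisor[of ?k e] by (simp add: minus_div_mult_eq_mod[symmetric] del: mod_less_divisor)
  have fits: "0 < w" "4 < (2::nat) ^ w" using numeral_fits by auto
  show ?thesis
  proof (cases "?r \<le> u")
    case True
    show ?thesis
    proof (cases "?r = 0")
      case True
      then show ?thesis
        using fit fit_r[of 0] fits jn trace rem
        by (simp add: bulk_def good_def mem p5 F flip: regs)
    next
      case False
      then show ?thesis
        using True fit fit_r[of ?r] fits jn rem bulk[of ?r]
        by (simp add: bulk_def good_def mem p5 F flip: regs)
    qed
  next
    case False
    show ?thesis
    proof (cases "u = 0")
      case True
      then show ?thesis
        using False fit fit_r[of 0] fits jn trace
        by (simp add: bulk_def good_def mem p5 F flip: regs)
    next
      case u: False
      then show ?thesis
        using False fit fit_r[of u] fits jn bulk[of u]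
        by (simp add: bulk_def good_def mem p5 F flip: regs)
    qed
  qed
qed

lemma open_new_spec:
  assumes good: "good st" and j: "regs st 0 < n" and F: "regs st 4 = 0"
    and p: "regs st 5 = p (regs st 0)" "regs st 6 = cap (regs st 2)"
    and small: "regs st 3 = 0 \<or> regs st 1 \<le> cap (regs st 2) div p (regs st 0)"
  shows "wp w open_new (\<lambda>t st'. good st' \<and> regs st' 0 = regs st 0 \<and> regs st' 2 = regs st 2 \<and>
    (regs st' 1 = 0 \<or> regs st' 3 = 0 \<and> regs st' 4 = 0) \<and> t \<le> 50) st"
proof -
  define j e i u where "j = regs st 0" "e = regs st (Suc 0)" "i = regs st 2" "u = regs st 3"
  note regs = this
  have trace: "trace j e i u 0 (out st)" and mem: "mem st = inp"
    using good F by (simp_all add: good_def regs)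
  note bnd = trace_bounds[OF trace]
  have jn: "j < n" using j by (simp add: regs)
  have p5: "regs st 5 = p j" "regs st 6 = cap i" using p by (simp_all add: regs)
  have fit: "e < 2 ^ w" "u < 2 ^ w" "i < 2 ^ w" "j < 2 ^ w" "u - Suc 0 < 2 ^ w" "cap i < 2 ^ w"
    "Suc (cap i) < 2 ^ w" "p j < 2 ^ w" "e * p j < 2 ^ w" "Suc (cap i) - e * p j < 2 ^ w"
    using bnd jn data_bounds(3)[OF jn] Suc_cap_le[OF bnd(6)]
    by (auto intro: fits fits_bound fits_mult less_imp_diff_less)
  show ?thesis
  proof (cases "0 < e \<and> 0 < u")
    case True
    then have "trace j 0 i (u - Suc 0) (Suc (cap i) - e * p j) (out st @ [i, Suc 0, e, j])"
      using trace_open[OF trace jn] small by (simp add: regs)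
    then show ?thesis
      using True fit numeral_fits jn
      by (simp add: open_new_def good_def mem p5 flip: regs)
  next
    case False
    then show ?thesis
      using fit numeral_fits jn trace
      by (auto simp: open_new_def good_def mem p5 F simp flip: regs)
  qed
qed

text \<open>\<open>trace_next_machine\<close> guarantees a further machine type, and a new job type
  has positive multiplicity, which restores \<open>e > 0\<close> for the next round.\<close>

lemma advance_spec:
  assumes good: "good st" and j: "regs st 0 < n"
    and e: "regs st 1 = 0 \<or> regs st 3 = 0 \<and> regs st 4 = 0"
  shows "wp w advance (\<lambda>t st'. good st' \<and> (regs st' 0 < n \<longrightarrow> 0 < regs st' 1) \<and>
    n + m - (regs st' 0 + regs st' 2) < n + m - (regs st 0 + regs st 2) \<and> t \<le> 50) st"
proof -
  define j e i u F where "j = regs st 0" "e = regs st (Suc 0)" "i = regs st 2" "u = regs st 3" "F = regs st 4"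
  note regs = this
  have trace: "trace j e i u F (out st)" and mem: "mem st = inp"
    using good by (simp_all add: good_def regs)
  note bnd = trace_bounds[OF trace]
  have jn: "j < n" using j by (simp add: regs)
  have fit: "e < 2 ^ w" "i < 2 ^ w" "j < 2 ^ w" "Suc i < 2 ^ w" "Suc j < 2 ^ w"
    using bnd jn length_bound by (auto intro!: fits_bound)
  show ?thesis
  proof (cases "e = 0")
    case True
    let ?st = "st\<lparr>regs := (regs st)(0 := Suc j)\<rparr>"
    have st: "mem ?st = inp" "regs ?st 0 \<le> n" using mem jn by simp_all
    note expr = job_exprs[OF st]
    have "trace (Suc j) (expr_val ?st eta_expr) i u F (out st)"
      using trace_next_job[of j i u F "out st" "expr_val ?st eta_expr"] trace True jn expr(4) by simp
    then show ?thesis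
      using True fit numeral_fits jn expr(2,4) pos(2)[of "Suc j"] bnd(6)
      by (auto simp: advance_def good_def mem expr_costs simp flip: regs)
  next
    case False
    then have uF: "u = 0" "F = 0" using e by (simp_all add: regs)
    have succ: "Suc i < m" "trace j e (Suc i) (\<mu> (Suc i)) 0 (out st)"
      using trace_next_machine[of j e i "out st"] trace jn False uF by simp_all
    let ?st = "st\<lparr>regs := (regs st)(2 := Suc i)\<rparr>"
    have st: "mem ?st = inp" "regs ?st 2 \<le> m" using mem succ(1) by simp_all
    note expr = machine_exprs[OF st]
    show ?thesis
      using False fit numeral_fits jn expr(2,4) succ uF
      by (auto simp: advance_def good_def mem expr_costs simp flip: regs)
  qed
qed

text \<open>Each block takes at most 50 steps and each test of register 4 adds 2, so the total is at
  most 50 + 52 + 102 + 50.\<close>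

lemma greedy_step_spec:
  assumes good: "good st" and j: "regs st 0 < n" and e: "0 < regs st 1"
  shows "wp w greedy_step (\<lambda>t st'. (good st' \<and> (regs st' 0 < n \<longrightarrow> 0 < regs st' 1)) \<and>
    n + m - (regs st' 0 + regs st' 2) < n + m - (regs st 0 + regs st 2) \<and> t \<le> 260) st"
  unfolding greedy_step_def
proof (rule wp_SeqI[OF fetch_spec[OF good j]], elim conjE)
  fix t1 :: nat and s1
  assume 1: "good s1" "regs s1 0 = regs st 0" "regs s1 1 = regs st 1" "regs s1 2 = regs st 2"
    "regs s1 5 = p (regs st 0)" "regs s1 6 = cap (regs st 2)" "t1 \<le> 50"
  have F_fits: "regs x 4 < 2 ^ w" if "good x" for x
    using trace_bounds(5)[OF conjunct2[OF that[unfolded good_def]]] by (rule fits)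
  have "wp w (If (Reg 4) fill_open Skip) (\<lambda>t st'. good st' \<and> regs st' 0 = regs st 0 \<and>
      regs st' 2 = regs st 2 \<and> regs st' 5 = p (regs st 0) \<and> regs st' 6 = cap (regs st 2) \<and>
      (regs st' 1 = 0 \<or> regs st' 4 = 0) \<and> t \<le> 52) s1"
  proof (cases "regs s1 4 = 0")
    case True
    then show ?thesis using 1 F_fits[OF 1(1)] by simp
  next
    case False
    have "wp w fill_open (\<lambda>t. (\<lambda>t st'. good st' \<and> regs st' 0 = regs st 0 \<and>
      regs st' 2 = regs st 2 \<and> regs st' 5 = p (regs st 0) \<and> regs st' 6 = cap (regs st 2) \<and>
      (regs st' 1 = 0 \<or> regs st' 4 = 0) \<and> t \<le> 52) (2 + t)) s1"
      by (rule wp_mono[OF fill_open_spec]) (use 1 j e False in auto)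
    then show ?thesis using False F_fits[OF 1(1)] by simp
  qed
  then show "wp w (Seq (If (Reg 4) fill_open Skip)
      (Seq (If (Reg 4) Skip (Seq bulk open_new)) advance))
    (\<lambda>t2 st'. (good st' \<and> (regs st' 0 < n \<longrightarrow> 0 < regs st' 1)) \<and>
    n + m - (regs st' 0 + regs st' 2) < n + m - (regs st 0 + regs st 2) \<and> t1 + t2 \<le> 260) s1"
  proof (rule wp_SeqI, elim conjE)
    fix t2 :: nat and s2
    assume 2: "good s2" "regs s2 0 = regs st 0" "regs s2 2 = regs st 2"
      "regs s2 5 = p (regs st 0)" "regs s2 6 = cap (regs st 2)" "regs s2 1 = 0 \<or> regs s2 4 = 0" "t2 \<le> 52"
    have "wp w (If (Reg 4) Skip (Seq bulk open_new)) (\<lambda>t st'. good st' \<and> regs st' 0 = regs st 0 \<and>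
        regs st' 2 = regs st 2 \<and> (regs st' 1 = 0 \<or> regs st' 3 = 0 \<and> regs st' 4 = 0) \<and> t \<le> 102) s2"
    proof (cases "regs s2 4 = 0")
      case True
      have "wp w (Seq bulk open_new) (\<lambda>t. (\<lambda>t st'. good st' \<and> regs st' 0 = regs st 0 \<and>
          regs st' 2 = regs st 2 \<and> (regs st' 1 = 0 \<or> regs st' 3 = 0 \<and> regs st' 4 = 0) \<and> t \<le> 102) (2 + t)) s2"
      proof (rule wp_SeqI[OF bulk_spec])
        fix t3 :: nat and s3
        assume 3: "good s3 \<and> regs s3 0 = regs s2 0 \<and> regs s3 2 = regs s2 2 \<and>
          regs s3 4 = 0 \<and> regs s3 5 = regs s2 5 \<and> regs s3 6 = regs s2 6 \<and>
          (regs s3 3 = 0 \<or> regs s3 1 \<le> cap (regs s2 2) div p (regs s2 0)) \<and> t3 \<le> 50"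
        show "wp w open_new (\<lambda>t4. (\<lambda>t st'. good st' \<and> regs st' 0 = regs st 0 \<and>
          regs st' 2 = regs st 2 \<and> (regs st' 1 = 0 \<or> regs st' 3 = 0 \<and> regs st' 4 = 0) \<and> t \<le> 102)
            (2 + (t3 + t4))) s3"
          by (rule wp_mono[OF open_new_spec]) (use 2 3 j in auto)
      qed (use 2 j True in auto)
      then show ?thesis using True F_fits[OF 2(1)] by simp
    next
      case False
      then show ?thesis using 2 F_fits[OF 2(1)] by simp
    qed
    then show "wp w (Seq (If (Reg 4) Skip (Seq bulk open_new)) advance)
      (\<lambda>t3 st'. (good st' \<and> (regs st' 0 < n \<longrightarrow> 0 < regs st' 1)) \<and>
      n + m - (regs st' 0 + regs st' 2) < n + m - (regs st 0 + regs st 2) \<and> t1 + (t2 + t3) \<le> 260) s2"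
    proof (rule wp_SeqI, elim conjE)
      fix t3 :: nat and s3
      assume 3: "good s3" "regs s3 0 = regs st 0" "regs s3 2 = regs st 2"
        "regs s3 1 = 0 \<or> regs s3 3 = 0 \<and> regs s3 4 = 0" "t3 \<le> 102"
      show "wp w advance
        (\<lambda>t4 st'. (good st' \<and> (regs st' 0 < n \<longrightarrow> 0 < regs st' 1)) \<and>
        n + m - (regs st' 0 + regs st' 2) < n + m - (regs st 0 + regs st 2) \<and>
        t1 + (t2 + (t3 + t4)) \<le> 260) s3"
        by (rule wp_mono[OF advance_spec]) (use 1(7) 2(7) 3 j in auto)
    qed
  qed
qed

definition final_good :: "state \<Rightarrow> bool" where
  "final_good st \<longleftrightarrow> mem st = inp \<and>
    (\<exists>cs. final_inv (regs st 2) (regs st 3) cs \<and> out st = encode_configs cs)"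

text \<open>The 0 completes the pending entry, so the output also encodes
  \<open>open_entry\<close>.\<close>

lemma close_spec:
  assumes good: "good st" and j: "regs st 0 = n"
  shows "wp w (If (Reg 4) (Write (Const 0)) Skip) (\<lambda>t st'. final_good st' \<and> t \<le> 4) st"
proof -
  define e i u F where "e = regs st (Suc 0)" "i = regs st 2" "u = regs st 3" "F = regs st 4"
  note regs = this
  have trace: "trace n e i u F (out st)" and mem: "mem st = inp"
    using good by (simp_all add: good_def regs j)
  obtain cs js where inv: "inv n e i u F cs js" and out: "out st = encode_configs cs @
    (if F > 0 then i # 1 # concat (map (\<lambda>(j, c). [c, j]) js) else [])"
    using trace by (auto simp: trace_def)
  have "encode_configs (cs @ open_entry i F js) = (if F > 0 then out st @ [0] else out st)"
    by (simp add: out open_entry_def)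
  then show ?thesis
    using inv_imp_final_inv[OF inv] fits[OF trace_bounds(5)[OF trace]] mem
    by (auto simp: final_good_def split: if_splits simp flip: regs
        intro!: exI[of _ "cs @ open_entry i F js"])
qed

lemma emit_empty_spec:
  assumes good: "final_good st" and i: "regs st 2 < m"
  shows "wp w emit_empty (\<lambda>t st'. final_good st' \<and> m - regs st' 2 < m - regs st 2 \<and> t \<le> 50) st"
proof -
  define i u where "i = regs st 2" "u = regs st 3"
  note regs = this
  obtain cs where cs: "final_inv i u cs" "out st = encode_configs cs" and mem: "mem st = inp"
    using good by (auto simp: final_good_def regs)
  have im: "i < m" using i by (simp add: regs)
  have "u \<le> \<mu> i" using cs(1) im by (auto simp: final_inv_def rest_def)
  then have fit: "u < 2 ^ w" "i < 2 ^ w" "Suc i < 2 ^ w"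
    using data_bounds(6)[OF im] im length_bound by (auto intro!: fits_bound)
  let ?st = "st\<lparr>regs := (regs st)(2 := Suc i)\<rparr>"
  have st: "mem ?st = inp" "regs ?st 2 \<le> m" using mem im by simp_all
  note expr = machine_exprs[OF st]
  have out: "expr_val (st\<lparr>out := os, regs := rs\<rparr>) mu_expr = expr_val (st\<lparr>regs := rs\<rparr>) mu_expr"
    "expr_fits w (st\<lparr>out := os, regs := rs\<rparr>) mu_expr = expr_fits w (st\<lparr>regs := rs\<rparr>) mu_expr"
    for os rs
    by (simp_all add: mu_expr_def)
  have final: "final_inv (Suc i) (expr_val ?st mu_expr) (if u > 0 then cs @ [(i, u, [])] else cs)"
    using final_inv_empty[OF cs(1) im, of "expr_val ?st mu_expr"] expr(4) by simp
  show ?thesis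
  proof (cases "u = 0")
    case True
    then show ?thesis
      using final fit numeral_fits im expr(2) mem cs(2)
      by (auto simp: emit_empty_def final_good_def expr_costs simp flip: regs)
  next
    case False
    then show ?thesis
      using final fit numeral_fits im expr(2) mem cs(2)
      by (auto simp: emit_empty_def final_good_def expr_costs out simp flip: regs
        intro!: exI[of _ "cs @ [(i, u, [])]"])
  qed
qed

lemma greedy_prog_spec:
  "wp w greedy_prog (\<lambda>t st. t \<le> 600 * (n + m) \<and> (\<exists>cs u. final_inv m u cs \<and> out st = encode_configs cs))
    (init_state (input I a b))"
  unfolding greedy_prog_def
proof (rule wp_SeqI)
  let ?s = "init_state (input I a b)"
  let ?s1 = "?s\<lparr>regs := (regs ?s)(1 := expr_val ?s eta_expr)\<rparr>"
  have mem: "mem ?s = inp" "mem ?s1 = inp" by (simp_all add: inp_def)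
  have regs: "regs ?s = (\<lambda>_. 0)" "out ?s = []" by (simp_all add: init_state_def)
  show "wp w (seq [Assign 1 eta_expr, Assign 3 mu_expr])
      (\<lambda>t st. good st \<and> 0 < regs st 1 \<and> t \<le> 20) ?s"
    using job_exprs[OF mem(1)] machine_exprs[OF mem(2)] nm_pos pos trace_init
    by (simp add: good_def mem expr_costs regs)
next
  fix t1 :: nat and s1
  assume 1: "good s1 \<and> 0 < regs s1 1 \<and> t1 \<le> 20"
  let ?Inv = "\<lambda>st. good st \<and> (regs st 0 < n \<longrightarrow> 0 < regs st 1)"
  let ?meas = "\<lambda>st. n + m - (regs st 0 + regs st 2)"
  let ?g = "Bin Sub (Mem (Const 0)) (Reg 0)"
  have n_fits: "n < 2 ^ w" "m < 2 ^ w" using length_bound by (auto intro: fits_bound)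
  show "wp w (Seq (While ?g greedy_step) (Seq (If (Reg 4) (Write (Const 0)) Skip)
      (While (Bin Sub (Mem (Const 1)) (Reg 2)) emit_empty)))
    (\<lambda>t2 st. t1 + t2 \<le> 600 * (n + m) \<and> (\<exists>cs u. final_inv m u cs \<and> out st = encode_configs cs)) s1"
  proof (rule wp_SeqI)
    show "wp w (While ?g greedy_step) (\<lambda>t st. ?Inv st \<and> expr_val st ?g = 0 \<and>
        t \<le> Suc (?meas s1) * (260 + expr_cost ?g + 1)) s1"
    proof (rule wp_While)
      fix st
      assume st: "?Inv st"
      then have mem: "mem st = inp" by (simp add: good_def)
      have "regs st 0 < bound" using st trace_bounds(1) by (auto simp: good_def)
      then show "expr_fits w st ?g"
        using n_fits numeral_fits by (simp add: mem inp_simps fits_bound less_imp_diff_less)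
      show "wp w greedy_step (\<lambda>t st'. ?Inv st' \<and> ?meas st' < ?meas st \<and> t \<le> 260) st"
        if "expr_val st ?g \<noteq> 0"
        using that st greedy_step_spec[of st] by (simp add: mem inp_simps)
    qed (use 1 in simp)
  next
    fix t2 :: nat and s2
    assume 2: "?Inv s2 \<and> expr_val s2 ?g = 0 \<and> t2 \<le> Suc (?meas s1) * (260 + expr_cost ?g + 1)"
    then have "regs s2 0 = n"
      using trace_bounds(7) by (auto simp: good_def inp_simps intro: antisym)
    show "wp w (Seq (If (Reg 4) (Write (Const 0)) Skip)
        (While (Bin Sub (Mem (Const 1)) (Reg 2)) emit_empty))
      (\<lambda>t3 st. t1 + (t2 + t3) \<le> 600 * (n + m) \<and>
        (\<exists>cs u. final_inv m u cs \<and> out st = encode_configs cs)) s2"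
    proof (rule wp_SeqI[OF close_spec[OF conjunct1[OF conjunct1[OF 2]] \<open>regs s2 0 = n\<close>]])
      fix t3 :: nat and s3
      assume 3: "final_good s3 \<and> t3 \<le> 4"
      let ?h = "Bin Sub (Mem (Const 1)) (Reg 2)"
      have "wp w (While ?h emit_empty) (\<lambda>t st. final_good st \<and> expr_val st ?h = 0 \<and>
          t \<le> Suc (m - regs s3 2) * (50 + expr_cost ?h + 1)) s3"
      proof (rule wp_While)
        fix st
        assume st: "final_good st"
        then have mem: "mem st = inp" by (simp add: final_good_def)
        have "regs st 2 < bound"
          using st length_bound by (auto simp: final_good_def final_inv_def)
        then show "expr_fits w st ?h"
          using n_fits numeral_fits by (simp add: mem inp_simps fits_bound less_imp_diff_less)
        show "wp w emit_empty (\<lambda>t st'. final_good st' \<and> m - regs st' 2 < m - regs st 2 \<and> t \<le> 50) st"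
          if "expr_val st ?h \<noteq> 0"
          using that st emit_empty_spec[of st] by (simp add: mem inp_simps)
      qed (use 3 in simp)
      then show "wp w (While ?h emit_empty)
        (\<lambda>t4 st. t1 + (t2 + (t3 + t4)) \<le> 600 * (n + m) \<and>
          (\<exists>cs u. final_inv m u cs \<and> out st = encode_configs cs)) s3"
      proof (rule wp_mono)
        fix t4 :: nat and s4
        assume 4: "final_good s4 \<and> expr_val s4 ?h = 0 \<and> t4 \<le> Suc (m - regs s3 2) * (50 + expr_cost ?h + 1)"
        have "t2 \<le> Suc (?meas s1) * 265" using 2 by simp
        also have "\<dots> \<le> Suc (n + m) * 265" by (intro mult_right_mono) auto
        finally have t2: "t2 \<le> Suc (n + m) * 265" .
        have "t4 \<le> Suc (m - regs s3 2) * 55" using 4 by simp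
        also have "\<dots> \<le> Suc m * 55" by (intro mult_right_mono) auto
        finally have "t4 \<le> Suc m * 55" .
        \<comment> \<open>The loops take at most \<open>265 * (n + m + 1)\<close> and
          \<open>55 * (m + 1)\<close> steps, the rest at most 24; as \<open>n\<close> and
          \<open>m\<close> are positive, 600 absorbs the constants.\<close>
        then have "t1 + (t2 + (t3 + t4)) \<le> 600 * (n + m)"
          using 1 t2 3 nm_pos by (cases n; cases m) auto
        moreover obtain cs where "final_inv (regs s4 2) (regs s4 3) cs" "out s4 = encode_configs cs"
          using 4 by (auto simp: final_good_def)
        moreover from this(1) have "regs s4 2 = m"
          using 4 by (auto simp: final_good_def final_inv_def inp_simps)
        ultimately show "t1 + (t2 + (t3 + t4)) \<le> 600 * (n + m) \<and>
          (\<exists>cs u. final_inv m u cs \<and> out s4 = encode_configs cs)"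
          by auto
      qed
    qed
  qed
qed

end

text \<open>Each of the \<open>2 * (n + m)\<close> numbers contributes at least 1 to the encoding
  size.\<close>

lemma length_le_encoding_size:
  assumes "hm_valid I"
  shows "real (length (job_types I) + length (machine_types I)) \<le> encoding_size I"
proof -
  have "(\<Sum>x\<leftarrow>hm_numbers I. 1) \<le> encoding_size I"
    unfolding encoding_size_def by (rule sum_list_mono) simp
  moreover have "(\<Sum>x\<leftarrow>hm_numbers I. 1 :: real) = real (length (hm_numbers I))"
    by (simp add: sum_list_triv)
  ultimately show ?thesis
    by (simp add: hm_numbers_def length_concat_pairs del: map_append)
qed

text \<open>Passes from reals to integers: each capacity \<open>T\<close> times speed is rounded up
  to the successor of its floor.\<close>

lemma greedy_if_preemptively_feasible:
  assumes valid: "hm_valid I" and b: "b > 0" and feas: "preemptively_feasible I (real a / real b)"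
  shows "greedy I a b"
proof
  let ?s = "\<lambda>i. fst (machine_types I ! i)" and ?\<mu> = "\<lambda>i. snd (machine_types I ! i)"
  let ?M = "{..<length (machine_types I)}"
  have jobs: "(\<Sum>x\<in>jobs I. ptime I x) =
      (\<Sum>j<length (job_types I). fst (job_types I ! j) * snd (job_types I ! j))"
    using sum_jobs[of "\<lambda>j. fst (job_types I ! j)" I] by (simp add: ptime_def mult.commute)
  have machines: "(\<Sum>y\<in>machines I. speed I y) = (\<Sum>i\<in>?M. ?\<mu> i * ?s i)"
    using sum_machines[of ?s I] by (simp add: speed_def)
  have "real (\<Sum>x\<in>jobs I. ptime I x) \<le> real a / real b * real (\<Sum>i\<in>?M. ?\<mu> i * ?s i)"
    using preemptively_feasible_volume[OF feas] unfolding machines by simp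
  also have "\<dots> = (\<Sum>i\<in>?M. real (?\<mu> i) * (real (a * ?s i) / real b))"
    by (simp add: sum_distrib_left algebra_simps)
  also have "\<dots> \<le> (\<Sum>i\<in>?M. real (?\<mu> i) * real (Suc (a * ?s i div b)))"
  proof (intro sum_mono mult_left_mono)
    fix i
    have "a * ?s i < b * Suc (a * ?s i div b)"
      using dividend_less_times_div[OF b] by simp
    then have "real (a * ?s i) \<le> real (Suc (a * ?s i div b)) * real b"
      by (simp only: of_nat_mult[symmetric] of_nat_le_iff mult.commute[of _ b] less_imp_le)
    then show "real (a * ?s i) / real b \<le> real (Suc (a * ?s i div b))"
      using b by (simp only: pos_divide_le_eq of_nat_0_less_iff)
  qed simp
  finally show "(\<Sum>j<length (job_types I). fst (job_types I ! j) * snd (job_types I ! j))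
    \<le> (\<Sum>i\<in>?M. ?\<mu> i * Suc (a * ?s i div b))"
    unfolding jobs by (simp only: of_nat_mult[symmetric] of_nat_sum[symmetric] of_nat_le_iff)
qed (use valid b in simp_all)

theorem theorem5:
  shows "\<exists>(alg :: prog) (d :: nat) (C :: real).
    \<forall>(I :: hm_instance) (a :: nat) (b :: nat).
      hm_valid I \<and> b > 0 \<and> preemptively_feasible I (real a / real b) \<longrightarrow>
      (\<exists>t final cs \<sigma>.
        exec (d * word_bits (input I a b)) alg (init_state (input I a b)) t final \<and>
        out final = encode_configs cs \<and>
        schedule I \<sigma> \<and> represents I cs \<sigma> \<and>
        makespan I \<sigma> \<le> real a / real b + real (p_max I) \<and>
        real t \<le> C * encoding_size I)"
proof (rule exI[of _ greedy_prog], rule exI[of _ 3], rule exI[of _ 600], intro allI impI, elim conjE)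
  fix I :: hm_instance and a b :: nat
  assume asm: "hm_valid I" "b > 0" "preemptively_feasible I (real a / real b)"
  interpret greedy I a b using greedy_if_preemptively_feasible[OF asm] .
  obtain t final cs u where run: "exec w greedy_prog (init_state (input I a b)) t final"
    "t \<le> 600 * (n + m)" "final_inv m u cs" "out final = encode_configs cs"
    using greedy_prog_spec by (auto simp: wp_def)
  obtain \<sigma> where "schedule I \<sigma>" "represents I cs \<sigma>"
    "makespan I \<sigma> \<le> real a / real b + real (p_max I)"
    using final_inv_schedule[OF run(3)] .
  moreover have "real t \<le> 600 * encoding_size I"
  proof -
    have "real t \<le> real (600 * (n + m))" using run(2) by (simp only: of_nat_le_iff)
    then show ?thesis using length_le_encoding_size[OF asm(1)] by simp
  qed
  ultimately show "\<exists>t final cs \<sigma>.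
      exec (3 * word_bits (input I a b)) greedy_prog (init_state (input I a b)) t final \<and>
      out final = encode_configs cs \<and> schedule I \<sigma> \<and> represents I cs \<sigma> \<and>
      makespan I \<sigma> \<le> real a / real b + real (p_max I) \<and> real t \<le> 600 * encoding_size I"
    using run(1,4) unfolding w_def by blast
qed

end
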